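(* Let $G$ be a Lie group with Lie algebra $\mathfrak{g}$, let $L:T^{(2)}G\to\mathbb{R}$ be a left-invariant second-order Lagrangian whose reduced Lagrangian $\ell:2\mathfrak{g}\to\mathbb{R}$ is hyper-regular, and let $\Phi:H\times G\to G$ be a left action of a Lie group $H$ on $G$ such that $$L\big([\Phi_h\circ g]^{(2)}_{\Phi_h(g_0)}\big)=L\big([g]^{(2)}_{g_0}\big)\qquad\text{for all }h\in H\text{ and all }[g]^{(2)}_{g_0}\in T^{(2)}G.$$ Let $\mathbf{J}:T^*(TG)\to\mathfrak{h}^*$ be the cotangent-lift momentum map associated with the tangent-lifted action $T\Phi:H\times TG\to TG$. Let $a>0$, let $g:[0,a]\to G$ be a solution of Hamilton's principle for $L$, let $\gamma=(g,\xi,u,\mu,\nu):[0,a]\to P^{(2)}G$ be its lift satisfying the HOHP equations $$\dot\mu=\operatorname{ad}^*_\xi\mu,\qquad \mu=\frac{\delta\ell}{\delta\xi}-\dot\nu,\qquad \nu=\frac{\delta\ell}{\delta u},\qquad \dot g=g\xi,\qquad \dot\xi=u,$$ and put $x(t)=(g(t),\xi(t),\mu(t),\nu(t))\in T^*(TG)$. Then $\mathbf{J}(x(t))=\mathbf{J}(x(0))$ for all $t\in[0,a]$.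
   Context: $T^{(2)}G$ is the second-order tangent bundle: classes $[g]^{(2)}_{g_0}$ of curves with $g(0)=g_0$ agreeing up to second derivatives at $t=0$; left trivialisation $T^{(2)}G\cong G\times2\mathfrak{g}$ sends $[g]^{(2)}_{g_0}$ to $(g(0),\xi(0),\dot\xi(0))$ with $\xi=g^{-1}\dot g$. $L$ is left-invariant if in this trivialisation it does not depend on the $G$-entry, and $\ell(\xi,u)$ is the induced function on $2\mathfrak{g}=\mathfrak{g}\times\mathfrak{g}$. $T^*(TG)\cong G\times\mathfrak{g}\times2\mathfrak{g}^*\ni(g,\xi,\mu,\nu)$ and $P^{(2)}G=T^{(2)}G\times_{TG}T^*(TG)\cong G\times2\mathfrak{g}\times2\mathfrak{g}^*\ni(g,\xi,u,\mu,\nu)$ by left trivialisation. Hyper-regularity means $\frac{\delta^2\ell}{\delta u^2}$ is non-degenerate and the map $(g,\xi,u,\mu,\nu)\mapsto(g,\xi,\mu,\nu)$ from $W_c=\{\nu=\frac{\delta\ell}{\delta u}(\xi,u)\}\subset P^{(2)}G$ to $T^*(TG)$ is a diffeomorphism. A smooth curve $g$ solves Hamilton's principle if $\int_0^aL(g,\dot g,\ddot g)\,dt$ is stationary at $g$ with respect to variations fixing $g(0),g(a),\dot g(0),\dot g(a)$; such a $g$ always admits a lift $\gamma$ as in the claim. For an action $\Psi$ of $H$ on a manifold $Q$ and $\zeta\in\mathfrak{h}$, the infinitesimal generator is $\zeta_Q(q)=\frac{d}{d\varepsilon}|_{\varepsilon=0}\Psi_{\exp(\varepsilon\zeta)}(q)$,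 and the cotangent-lift momentum map $\mathbf{J}:T^*Q\to\mathfrak{h}^*$ is defined by $\langle\mathbf{J}(\alpha_q),\zeta\rangle=\langle\alpha_q,\zeta_Q(q)\rangle$ for $\alpha_q\in T^*_qQ$, $\zeta\in\mathfrak{h}$; here it is applied with $Q=TG$ and $\Psi=T\Phi$. In the trivialisation, the pairing of $(g,\xi,\mu,\nu)\in T^*(TG)$ with a tangent vector $(\delta g,\delta\xi)$ at $(g,\xi)$ is $\langle\mu,g^{-1}\delta g\rangle+\langle\nu,\delta\xi\rangle$. *)

theory Defs
  imports "HOL-Analysis.Analysis"
begin

section \<open>Smooth maps and manifolds\<close>

text \<open>Only used for open \<open>S\<close>; for a finite-dimensional domain this is the usual
  class of n times continuously differentiable maps.\<close>

primrec times_differentiable_on ::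
  "nat \<Rightarrow> 'a::real_normed_vector set \<Rightarrow> ('a \<Rightarrow> 'b::real_normed_vector) \<Rightarrow> bool" where
  "times_differentiable_on 0 S f \<longleftrightarrow> continuous_on S f"
| "times_differentiable_on (Suc n) S f \<longleftrightarrow>
     (\<forall>x\<in>S. f differentiable (at x)) \<and>
     (\<forall>v. times_differentiable_on n S (\<lambda>x. frechet_derivative f (at x) v))"

definition smooth_on :: "'a::real_normed_vector set \<Rightarrow> ('a \<Rightarrow> 'b::real_normed_vector) \<Rightarrow> bool" where
  "smooth_on S f \<longleftrightarrow> (\<forall>n. times_differentiable_on n S f)"

text \<open>A chart is a pair of its domain and its coordinate map.\<close>

type_synonym ('p, 'e) atlas = "('p set \<times> ('p \<Rightarrow> 'e)) set"

definition smooth_atlas ::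
  "('p::topological_space, 'e::real_normed_vector) atlas \<Rightarrow> bool" where
  "smooth_atlas A \<longleftrightarrow>
     (\<Union>(U, \<phi>)\<in>A. U) = UNIV \<and>
     (\<forall>(U, \<phi>)\<in>A. open U \<and> open (\<phi> ` U) \<and> homeomorphism U (\<phi> ` U) \<phi> (inv_into U \<phi>)) \<and>
     (\<forall>(U, \<phi>)\<in>A. \<forall>(V, \<psi>)\<in>A. smooth_on (\<phi> ` (U \<inter> V)) (\<psi> \<circ> inv_into U \<phi>))"

definition vec_atlas :: "('e::real_normed_vector, 'e) atlas" where
  "vec_atlas = {(UNIV, id)}"

definition prod_atlas :: "('p, 'e) atlas \<Rightarrow> ('q, 'f) atlas \<Rightarrow> ('p \<times> 'q, 'e \<times> 'f) atlas" where
  "prod_atlas A B = {(U \<times> V, map_prod \<phi> \<psi>) | U \<phi> V \<psi>. (U, \<phi>) \<in> A \<and> (V, \<psi>) \<in> B}"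

text \<open>Smoothness on an arbitrary subset \<open>S\<close>: locally, in charts, \<open>f\<close> agrees on \<open>S\<close> with a
  smooth map defined on an open set. This covers open sets, closed intervals and embedded
  submanifolds.\<close>

definition smooth_map_on ::
  "('p::topological_space, 'e::real_normed_vector) atlas \<Rightarrow>
   ('q::topological_space, 'f::real_normed_vector) atlas \<Rightarrow> 'p set \<Rightarrow> ('p \<Rightarrow> 'q) \<Rightarrow> bool" where
  "smooth_map_on A B S f \<longleftrightarrow>
     (\<forall>p\<in>S. \<exists>(U, \<phi>)\<in>A. \<exists>(V, \<psi>)\<in>B. \<exists>W F.
        open W \<and> p \<in> W \<and> W \<subseteq> U \<and> f ` (W \<inter> S) \<subseteq> V \<and>
        smooth_on (\<phi> ` W) F \<and> (\<forall>q\<in>W \<inter> S. \<psi> (f q) = F (\<phi> q)))"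

definition diffeomorphism_on ::
  "('p::topological_space, 'e::real_normed_vector) atlas \<Rightarrow>
   ('q::topological_space, 'f::real_normed_vector) atlas \<Rightarrow> 'p set \<Rightarrow> 'q set \<Rightarrow> ('p \<Rightarrow> 'q) \<Rightarrow> bool"
where
  "diffeomorphism_on A B S T f \<longleftrightarrow>
     bij_betw f S T \<and> smooth_map_on A B S f \<and> smooth_map_on B A T (inv_into S f)"


section \<open>Lie groups\<close>

record ('g, 'e) lie_data =
  mul :: "'g \<Rightarrow> 'g \<Rightarrow> 'g"
  neutral :: "'g"
  inver :: "'g \<Rightarrow> 'g"
  charts :: "('g, 'e) atlas"

text \<open>The model space is a finite-dimensional real inner product space, that is, some
  \<open>\<real>\<^sup>n\<close>; unlike the class \<open>euclidean_space\<close> this includes \<open>n = 0\<close>, so discrete groups are not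
  excluded. (Completeness is automatic in finite dimension.)\<close>

definition lie_group ::
  "('g::{t2_space, second_countable_topology}, 'e::{real_inner, banach}) lie_data \<Rightarrow> bool" where
  "lie_group G \<longleftrightarrow>
     group (mul G) (neutral G) (inver G) \<and>
     (\<exists>B::'e set. finite B \<and> span B = UNIV) \<and>
     smooth_atlas (charts G) \<and>
     smooth_map_on (prod_atlas (charts G) (charts G)) (charts G) UNIV (\<lambda>(x, y). mul G x y) \<and>
     smooth_map_on (charts G) (charts G) UNIV (inver G)"

text \<open>The Lie algebra, as a vector space, is the tangent space at the identity. It is identified
  with the model space \<open>'e\<close> by an arbitrary but fixed chart around the identity; its dual is then
  the space \<open>'e \<Rightarrow>\<^sub>L real\<close>.\<close>

definition unit_chart :: "('g, 'e) lie_data \<Rightarrow> 'g \<Rightarrow> 'e" where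
  "unit_chart G = (SOME \<phi>. \<exists>U. (U, \<phi>) \<in> charts G \<and> neutral G \<in> U)"

text \<open>The vector $c(t)^{-1}\dot c(t)$: left translation carries the velocity of \<open>c\<close> at \<open>t\<close> to the
  velocity at \<open>s = t\<close> of \<open>s \<mapsto> c(t)\<inverse> c(s)\<close>, which passes through the identity.\<close>

definition has_left_velocity ::
  "('g, 'e::real_normed_vector) lie_data \<Rightarrow> (real \<Rightarrow> 'g) \<Rightarrow> 'e \<Rightarrow> real \<Rightarrow> real set \<Rightarrow> bool" where
  "has_left_velocity G c \<xi> t S \<longleftrightarrow>
     ((\<lambda>s. unit_chart G (mul G (inver G (c t)) (c s))) has_vector_derivative \<xi>) (at t within S)"

definition left_velocity ::
  "('g, 'e::real_normed_vector) lie_data \<Rightarrow> (real \<Rightarrow> 'g) \<Rightarrow> real \<Rightarrow> real set \<Rightarrow> 'e" where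
  "left_velocity G c t S =
     vector_derivative (\<lambda>s. unit_chart G (mul G (inver G (c t)) (c s))) (at t within S)"

definition one_parameter_subgroup ::
  "('g::topological_space, 'e::real_normed_vector) lie_data \<Rightarrow> 'e \<Rightarrow> (real \<Rightarrow> 'g) \<Rightarrow> bool" where
  "one_parameter_subgroup G \<xi> c \<longleftrightarrow>
     smooth_map_on vec_atlas (charts G) UNIV c \<and>
     (\<forall>s t. c (s + t) = mul G (c s) (c t)) \<and>
     has_left_velocity G c \<xi> 0 UNIV"

definition lie_exp :: "('g::topological_space, 'e::real_normed_vector) lie_data \<Rightarrow> 'e \<Rightarrow> 'g" where
  "lie_exp G \<xi> = (THE c. one_parameter_subgroup G \<xi> c) 1"

definition Ad ::
  "('g::topological_space, 'e::real_normed_vector) lie_data \<Rightarrow> 'g \<Rightarrow> 'e \<Rightarrow> 'e" where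
  "Ad G g \<eta> = left_velocity G (\<lambda>s. mul G (mul G g (lie_exp G (s *\<^sub>R \<eta>))) (inver G g)) 0 UNIV"

definition ad ::
  "('g::topological_space, 'e::real_normed_vector) lie_data \<Rightarrow> 'e \<Rightarrow> 'e \<Rightarrow> 'e" where
  "ad G \<xi> \<eta> = vector_derivative (\<lambda>t. Ad G (lie_exp G (t *\<^sub>R \<xi>)) \<eta>) (at 0)"

text \<open>Here and below \<open>Blinfun\<close> is only applied to maps that are linear, hence bounded in finite
  dimension.\<close>

definition ad_star ::
  "('g::topological_space, 'e::real_normed_vector) lie_data \<Rightarrow>
   'e \<Rightarrow> ('e \<Rightarrow>\<^sub>L real) \<Rightarrow> ('e \<Rightarrow>\<^sub>L real)" where
  "ad_star G \<xi> \<mu> = Blinfun (\<lambda>\<eta>. blinfun_apply \<mu> (ad G \<xi> \<eta>))"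

definition left_action ::
  "('h::topological_space, 'f::real_normed_vector) lie_data \<Rightarrow>
   ('g::topological_space, 'e::real_normed_vector) lie_data \<Rightarrow> ('h \<Rightarrow> 'g \<Rightarrow> 'g) \<Rightarrow> bool" where
  "left_action H G \<Phi> \<longleftrightarrow>
     (\<forall>g. \<Phi> (neutral H) g = g) \<and>
     (\<forall>h k g. \<Phi> (mul H h k) g = \<Phi> h (\<Phi> k g)) \<and>
     smooth_map_on (prod_atlas (charts H) (charts G)) (charts G) UNIV (\<lambda>(h, g). \<Phi> h g)"


section \<open>The second-order tangent bundle and second-order Lagrangians\<close>

definition curve_at_0 ::
  "('g::topological_space, 'e::real_normed_vector) lie_data \<Rightarrow> (real \<Rightarrow> 'g) \<Rightarrow> bool" where
  "curve_at_0 G c \<longleftrightarrow> (\<exists>r>0. smooth_map_on vec_atlas (charts G) {-r<..<r} c)"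

text \<open>The class $[c]^{(2)}_{c(0)}$. Elements of $T^{(2)}G$ are exactly these classes, for curves
  \<open>c\<close> smooth around \<open>0\<close>.\<close>

definition jet2 ::
  "('g::topological_space, 'e::real_normed_vector) lie_data \<Rightarrow> (real \<Rightarrow> 'g) \<Rightarrow> (real \<Rightarrow> 'g) set" where
  "jet2 G c = {d. curve_at_0 G d \<and> d 0 = c 0 \<and>
     (\<forall>(U, \<phi>)\<in>charts G. c 0 \<in> U \<longrightarrow>
        vector_derivative (\<phi> \<circ> d) (at 0) = vector_derivative (\<phi> \<circ> c) (at 0) \<and>
        vector_derivative (\<lambda>t. vector_derivative (\<phi> \<circ> d) (at t)) (at 0) =
        vector_derivative (\<lambda>t. vector_derivative (\<phi> \<circ> c) (at t)) (at 0))}"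

text \<open>The left trivialisation of the class of \<open>c\<close>, in terms of the representative \<open>c\<close>.\<close>

definition left_triv2 ::
  "('g, 'e::real_normed_vector) lie_data \<Rightarrow> (real \<Rightarrow> 'g) \<Rightarrow> 'g \<times> 'e \<times> 'e" where
  "left_triv2 G c =
     (c 0, left_velocity G c 0 UNIV, vector_derivative (\<lambda>t. left_velocity G c t UNIV) (at 0))"

definition left_invariant ::
  "('g::topological_space, 'e::real_normed_vector) lie_data \<Rightarrow> ((real \<Rightarrow> 'g) set \<Rightarrow> real) \<Rightarrow> bool"
where
  "left_invariant G L \<longleftrightarrow>
     (\<forall>c d. curve_at_0 G c \<longrightarrow> curve_at_0 G d \<longrightarrow> snd (left_triv2 G c) = snd (left_triv2 G d) \<longrightarrow>
        L (jet2 G c) = L (jet2 G d))"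

definition reduced_lagrangian ::
  "('g::topological_space, 'e::real_normed_vector) lie_data \<Rightarrow> ((real \<Rightarrow> 'g) set \<Rightarrow> real) \<Rightarrow>
   'e \<times> 'e \<Rightarrow> real" where
  "reduced_lagrangian G L p =
     L (jet2 G (SOME c. curve_at_0 G c \<and> left_triv2 G c = (neutral G, p)))"

definition delta_xi ::
  "('e::real_normed_vector \<times> 'e \<Rightarrow> real) \<Rightarrow> 'e \<times> 'e \<Rightarrow> ('e \<Rightarrow>\<^sub>L real)" where
  "delta_xi l = (\<lambda>(\<xi>, u). Blinfun (frechet_derivative (\<lambda>\<xi>'. l (\<xi>', u)) (at \<xi>)))"

definition delta_u ::
  "('e::real_normed_vector \<times> 'e \<Rightarrow> real) \<Rightarrow> 'e \<times> 'e \<Rightarrow> ('e \<Rightarrow>\<^sub>L real)" where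
  "delta_u l = (\<lambda>(\<xi>, u). Blinfun (frechet_derivative (\<lambda>u'. l (\<xi>, u')) (at u)))"

definition delta2_u ::
  "('e::real_normed_vector \<times> 'e \<Rightarrow> real) \<Rightarrow> 'e \<times> 'e \<Rightarrow> 'e \<Rightarrow> ('e \<Rightarrow>\<^sub>L real)" where
  "delta2_u l = (\<lambda>(\<xi>, u). frechet_derivative (\<lambda>u'. delta_u l (\<xi>, u')) (at u))"

text \<open>In the left trivialisations, $T^*(TG)$ is the type \<open>'g \<times> 'e \<times> ('e \<Rightarrow>\<^sub>L real) \<times> ('e \<Rightarrow>\<^sub>L real)\<close>
  of tuples \<open>(g, \<xi>, \<mu>, \<nu>)\<close>, and $P^{(2)}G$ consists of the tuples \<open>(g, \<xi>, u, \<mu>, \<nu>)\<close>.\<close>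

definition W_c ::
  "('e::real_normed_vector \<times> 'e \<Rightarrow> real) \<Rightarrow>
   ('g \<times> 'e \<times> 'e \<times> ('e \<Rightarrow>\<^sub>L real) \<times> ('e \<Rightarrow>\<^sub>L real)) set" where
  "W_c l = {(g, \<xi>, u, \<mu>, \<nu>). \<nu> = delta_u l (\<xi>, u)}"

definition hyper_regular ::
  "('g::topological_space, 'e::real_normed_vector) lie_data \<Rightarrow> ('e \<times> 'e \<Rightarrow> real) \<Rightarrow> bool" where
  "hyper_regular G l \<longleftrightarrow>
     (\<forall>\<xi> u v. (\<forall>w. blinfun_apply (delta2_u l (\<xi>, u) v) w = 0) \<longrightarrow> v = 0) \<and>
     diffeomorphism_on (prod_atlas (charts G) vec_atlas) (prod_atlas (charts G) vec_atlas)
       (W_c l) UNIV (\<lambda>(g, \<xi>, u, \<mu>, \<nu>). (g, \<xi>, \<mu>, \<nu>))"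


section \<open>Hamilton's principle and the second-order Hamilton--Pontryagin equations\<close>

text \<open>\<open>c \<epsilon> t\<close> with \<open>\<epsilon>\<close> the deformation parameter. Since the base points at \<open>t = 0\<close> and \<open>t = a\<close> are
  fixed, fixing the velocities there amounts to fixing the left-trivialised velocities.\<close>

definition fixed_end_variation ::
  "('g::topological_space, 'e::real_normed_vector) lie_data \<Rightarrow> real \<Rightarrow> (real \<Rightarrow> 'g) \<Rightarrow>
   (real \<Rightarrow> real \<Rightarrow> 'g) \<Rightarrow> bool" where
  "fixed_end_variation G a g c \<longleftrightarrow>
     (\<exists>r>0. smooth_map_on vec_atlas (charts G) ({-r<..<r} \<times> {0..a}) (\<lambda>(\<epsilon>, t). c \<epsilon> t) \<and>
        (\<forall>t\<in>{0..a}. c 0 t = g t) \<and>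
        (\<forall>\<epsilon>\<in>{-r<..<r}. \<forall>t\<in>{0, a}. c \<epsilon> t = g t \<and>
           left_velocity G (c \<epsilon>) t {0..a} = left_velocity G g t {0..a}))"

text \<open>The values of the integrand at the two end points, where the curve need not be defined on
  both sides, do not influence the integral.\<close>

definition action_integral ::
  "('g::topological_space, 'e::real_normed_vector) lie_data \<Rightarrow> ((real \<Rightarrow> 'g) set \<Rightarrow> real) \<Rightarrow>
   real \<Rightarrow> (real \<Rightarrow> 'g) \<Rightarrow> real" where
  "action_integral G L a g = integral {0..a} (\<lambda>t. L (jet2 G (\<lambda>s. g (t + s))))"

definition solves_hamilton_principle ::
  "('g::topological_space, 'e::real_normed_vector) lie_data \<Rightarrow> ((real \<Rightarrow> 'g) set \<Rightarrow> real) \<Rightarrow>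
   real \<Rightarrow> (real \<Rightarrow> 'g) \<Rightarrow> bool" where
  "solves_hamilton_principle G L a g \<longleftrightarrow>
     smooth_map_on vec_atlas (charts G) {0..a} g \<and>
     (\<forall>c. fixed_end_variation G a g c \<longrightarrow>
        ((\<lambda>\<epsilon>. action_integral G L a (c \<epsilon>)) has_real_derivative 0) (at 0))"

definition HOHP_equations ::
  "('g::topological_space, 'e::real_normed_vector) lie_data \<Rightarrow> ('e \<times> 'e \<Rightarrow> real) \<Rightarrow> real \<Rightarrow>
   (real \<Rightarrow> 'g) \<Rightarrow> (real \<Rightarrow> 'e) \<Rightarrow> (real \<Rightarrow> 'e) \<Rightarrow>
   (real \<Rightarrow> ('e \<Rightarrow>\<^sub>L real)) \<Rightarrow> (real \<Rightarrow> ('e \<Rightarrow>\<^sub>L real)) \<Rightarrow> bool" where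
  "HOHP_equations G l a g \<xi> u \<mu> \<nu> \<longleftrightarrow>
     (\<forall>t\<in>{0..a}.
        (\<mu> has_vector_derivative ad_star G (\<xi> t) (\<mu> t)) (at t within {0..a}) \<and>
        (\<exists>\<nu>'. (\<nu> has_vector_derivative \<nu>') (at t within {0..a}) \<and>
              \<mu> t = delta_xi l (\<xi> t, u t) - \<nu>') \<and>
        \<nu> t = delta_u l (\<xi> t, u t) \<and>
        has_left_velocity G g (\<xi> t) t {0..a} \<and>
        (\<xi> has_vector_derivative u t) (at t within {0..a}))"


section \<open>The cotangent-lift momentum map on the cotangent bundle of TG\<close>

text \<open>\<open>TF\<close> in the left trivialisation \<open>TG \<cong> G \<times> \<gg>\<close>; the curve \<open>t \<mapsto> g exp(t\<xi>)\<close> represents the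
  tangent vector \<open>(g, \<xi>)\<close>.\<close>

definition tangent_map ::
  "('g::topological_space, 'e::real_normed_vector) lie_data \<Rightarrow> ('g \<Rightarrow> 'g) \<Rightarrow> 'g \<times> 'e \<Rightarrow> 'g \<times> 'e"
where
  "tangent_map G F =
     (\<lambda>(g, \<xi>). (F g, left_velocity G (\<lambda>t. F (mul G g (lie_exp G (t *\<^sub>R \<xi>)))) 0 UNIV))"

text \<open>\<open>\<zeta>\<^sub>T\<^sub>G(g, \<xi>)\<close>, as the pair $(g^{-1}\delta g, \delta\xi)$.\<close>

definition generator_TG ::
  "('h::topological_space, 'f::real_normed_vector) lie_data \<Rightarrow>
   ('g::topological_space, 'e::real_normed_vector) lie_data \<Rightarrow> ('h \<Rightarrow> 'g \<Rightarrow> 'g) \<Rightarrow>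
   'f \<Rightarrow> 'g \<times> 'e \<Rightarrow> 'e \<times> 'e" where
  "generator_TG H G \<Phi> \<zeta> q =
     (left_velocity G (\<lambda>\<epsilon>. fst (tangent_map G (\<Phi> (lie_exp H (\<epsilon> *\<^sub>R \<zeta>))) q)) 0 UNIV,
      vector_derivative (\<lambda>\<epsilon>. snd (tangent_map G (\<Phi> (lie_exp H (\<epsilon> *\<^sub>R \<zeta>))) q)) (at 0))"

definition momentum_map ::
  "('h::topological_space, 'f::real_normed_vector) lie_data \<Rightarrow>
   ('g::topological_space, 'e::real_normed_vector) lie_data \<Rightarrow> ('h \<Rightarrow> 'g \<Rightarrow> 'g) \<Rightarrow>
   'g \<times> 'e \<times> ('e \<Rightarrow>\<^sub>L real) \<times> ('e \<Rightarrow>\<^sub>L real) \<Rightarrow> ('f \<Rightarrow>\<^sub>L real)" where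
  "momentum_map H G \<Phi> = (\<lambda>(g, \<xi>, \<mu>, \<nu>).
     Blinfun (\<lambda>\<zeta>. blinfun_apply \<mu> (fst (generator_TG H G \<Phi> \<zeta> (g, \<xi>))) +
                  blinfun_apply \<nu> (snd (generator_TG H G \<Phi> \<zeta> (g, \<xi>)))))"

end

theory Submission
  imports Defs
begin

text \<open>For \<open>\<zeta>\<close> in the Lie algebra of \<open>H\<close> put \<open>g\<^sub>\<epsilon>(t) = \<Phi>(exp(\<epsilon>\<zeta>), g(t))\<close>, let \<open>\<xi>\<^sub>\<epsilon>\<close> be its left velocity in \<open>t\<close>
  and let \<open>\<eta>(t)\<close> be its left velocity in \<open>\<epsilon>\<close> at \<open>\<epsilon> = 0\<close>. The generator on \<open>TG\<close> at \<open>(g(t), \<xi>(t))\<close> is the pair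
  \<open>(\<eta>, \<delta>\<xi>)\<close> with \<open>\<delta>\<xi> = \<partial>\<xi>\<^sub>\<epsilon>/\<partial>\<epsilon>\<close>, so the momentum paired with \<open>\<zeta>\<close> is \<open>\<mu>(\<eta>) + \<nu>(\<delta>\<xi>)\<close>. The Maurer--Cartan
  equation gives \<open>\<delta>\<xi> = d\<eta>/dt + ad(\<xi>, \<eta>)\<close>; inserting the equations of motion, the time derivative of the momentum
  becomes the derivative of \<open>l(\<xi>\<^sub>\<epsilon>, d\<xi>\<^sub>\<epsilon>/dt)\<close> in \<open>\<epsilon>\<close> at \<open>0\<close>, which vanishes because the Lagrangian is
  invariant under \<open>H\<close>.

  The exponential maps are given by a definite description, so one-parameter subgroups have to be shown to exist and
  to be unique. A solution of the left-invariant differential equation near \<open>0\<close> is found by Picard iteration and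
  extended by repeated use of \<open>c(t) = c(t/2) c(t/2)\<close>. Uniqueness holds because \<open>c(t) d(t)\<inverse>\<close> has zero left
  velocity whenever \<open>c\<close> and \<open>d\<close> have equal left velocities.\<close>

section \<open>Calculus in finite-dimensional inner product spaces\<close>

abbreviation FD :: "('a::real_normed_vector \<Rightarrow> 'b::real_normed_vector) \<Rightarrow> 'a \<Rightarrow> 'a \<Rightarrow> 'b" where
  "FD f x v \<equiv> frechet_derivative f (at x) v"

text \<open>A predicate on types rather than the class \<open>euclidean_space\<close>, so that the
  condition in \<open>lie_group\<close> can be used as it stands, dimension 0 included.\<close>

definition finite_dim :: "'a::real_vector itself \<Rightarrow> bool" where
  "finite_dim _ \<longleftrightarrow> (\<exists>B::'a set. finite B \<and> span B = UNIV)"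

lemma finite_dim_euclidean: "finite_dim TYPE('a::euclidean_space)"
  unfolding finite_dim_def using finite_Basis span_Basis by blast

lemma finite_dim_prod:
  assumes "finite_dim TYPE('a::real_vector)" "finite_dim TYPE('b::real_vector)"
  shows "finite_dim TYPE('a \<times> 'b)"
proof -
  obtain B C where B: "finite B" "span B = (UNIV::'a set)" and C: "finite C" "span C = (UNIV::'b set)"
    using assms unfolding finite_dim_def by blast
  let ?S = "(\<lambda>b. (b, 0::'b)) ` B \<union> (\<lambda>c. (0::'a, c)) ` C"
  have "(x, 0) \<in> span ?S" for x :: 'a
  proof -
    have "linear (\<lambda>x. (x, 0::'b))" by (auto intro!: linearI)
    then have "(\<lambda>b. (b, 0::'b)) ` span B = span ((\<lambda>b. (b, 0::'b)) ` B)"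
      by (rule linear_span_image [symmetric])
    then have "(x, 0) \<in> span ((\<lambda>b. (b, 0::'b)) ` B)" using B by auto
    then show ?thesis using span_mono[of "(\<lambda>b. (b, 0::'b)) ` B" ?S] by blast
  qed
  moreover have "(0, y) \<in> span ?S" for y :: 'b
  proof -
    have "linear (\<lambda>x. (0::'a, x))" by (auto intro!: linearI)
    then have "(\<lambda>b. (0::'a, b)) ` span C = span ((\<lambda>b. (0::'a, b)) ` C)"
      by (rule linear_span_image [symmetric])
    then have "(0, y) \<in> span ((\<lambda>b. (0::'a, b)) ` C)" using C by auto
    then show ?thesis using span_mono[of "(\<lambda>b. (0::'a, b)) ` C" ?S] by blast
  qed
  ultimately have "(x, y) \<in> span ?S" for x y
    using span_add[of "(x,0)" ?S "(0,y)"] by simp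
  then have "span ?S = UNIV" by auto
  then show ?thesis unfolding finite_dim_def using B C by (metis finite_UnI finite_imageI)
qed

text \<open>The coefficient vectors are those of an orthogonal basis; \<open>euclidean_space\<close> lemmas do not apply since the
  dimension may be \<open>0\<close>.\<close>

lemma finite_dim_coordinates:
  assumes "finite_dim TYPE('a::real_inner)"
  obtains B :: "'a::real_inner set" and c where "finite B" "\<And>x. x = (\<Sum>b\<in>B. (x \<bullet> c b) *\<^sub>R b)"
proof -
  obtain B0 where "finite B0" "span B0 = (UNIV::'a set)"
    using assms unfolding finite_dim_def by blast
  then obtain B where B: "finite B" "span B = (UNIV::'a set)" "pairwise orthogonal B"
    using basis_orthogonal by metis
  have *: "x = (\<Sum>b\<in>B. (x \<bullet> (b /\<^sub>R (b \<bullet> b))) *\<^sub>R b)" for x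
  proof -
    have "x \<in> span B" using B by simp
    then obtain r where r: "x = (\<Sum>b\<in>B. r b *\<^sub>R b)"
      unfolding span_finite[OF B(1)] by blast
    have "(x \<bullet> (b /\<^sub>R (b \<bullet> b))) *\<^sub>R b = r b *\<^sub>R b" if b: "b \<in> B" for b
    proof -
      have "x \<bullet> b = (\<Sum>d\<in>B. r d * (d \<bullet> b))" unfolding r by (simp add: inner_sum_left)
      also have "\<dots> = (\<Sum>d\<in>B. if d = b then r b * (b \<bullet> b) else 0)"
        by (rule sum.cong) (use B(3) b in \<open>auto simp: pairwise_def orthogonal_def\<close>)
      also have "\<dots> = r b * (b \<bullet> b)" using B b by simp
      \<comment> \<open>An orthogonal spanning set may contain 0; there the coefficient vector is 0
        as well and both terms vanish.\<close>
      finally show ?thesis by (cases "b = 0") auto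
    qed
    then show ?thesis using r by (metis (no_types, lifting) sum.cong)
  qed
  show thesis by (rule that[OF B(1) *])
qed

text \<open>The coordinates are inner products, hence bounded, and a linear map is a finite sum of
  them times fixed vectors. This makes \<open>Blinfun\<close> in \<open>ad_star\<close>
  meaningful.\<close>

lemma finite_dim_bounded_linear:
  assumes "finite_dim TYPE('a::real_inner)" and "linear (f :: 'a \<Rightarrow> 'b::real_normed_vector)"
  shows "bounded_linear f"
proof -
  obtain B and c where B: "finite B" "\<And>x::'a. x = (\<Sum>b\<in>B. (x \<bullet> c b) *\<^sub>R b)"
    using finite_dim_coordinates[OF assms(1)] by metis
  have "f (\<Sum>b\<in>B. (x \<bullet> c b) *\<^sub>R b) = (\<Sum>b\<in>B. (x \<bullet> c b) *\<^sub>R f b)" for x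
    by (simp add: linear_sum[OF assms(2)] linear_scale[OF assms(2)])
  then have fx: "f x = (\<Sum>b\<in>B. (x \<bullet> c b) *\<^sub>R f b)" for x
    unfolding B(2)[symmetric] .
  have "f = (\<lambda>x. \<Sum>b\<in>B. (x \<bullet> c b) *\<^sub>R f b)" by (rule ext) (rule fx)
  moreover have "bounded_linear (\<lambda>x. \<Sum>b\<in>B. (x \<bullet> c b) *\<^sub>R f b)"
    by (intro bounded_linear_sum bounded_linear_scaleR_const bounded_linear_inner_left)
  ultimately show ?thesis by (simp only:)
qed

section \<open>Closure properties of finitely often differentiable maps\<close>

lemma times_differentiable_on_cong:
  assumes "open S" "times_differentiable_on n S f" "\<And>x. x \<in> S \<Longrightarrow> f x = g x"
  shows "times_differentiable_on n S g"
  using assms(2,3)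
proof (induction n arbitrary: f g)
  case 0
  then show ?case using continuous_on_cong by force
next
  case (Suc n)
  have d: "(g has_derivative FD f x) (at x)" if "x \<in> S" for x
  proof (rule has_derivative_transform_within_open[OF _ \<open>open S\<close> that])
    show "(f has_derivative FD f x) (at x)"
      using Suc.prems(1) that by (auto simp: frechet_derivative_works)
  qed (use Suc.prems in auto)
  then have "frechet_derivative g (at x) = frechet_derivative f (at x)" if "x \<in> S" for x
    using frechet_derivative_at that by metis
  then have "times_differentiable_on n S (\<lambda>x. FD g x v)" for v
    using Suc.IH[of "\<lambda>x. FD f x v" "\<lambda>x. FD g x v"] Suc.prems by auto
  then show ?case using d by (auto simp: differentiable_def)
qed

text \<open>Lets an induction step work with an explicit formula \<open>f'\<close> for the
  derivative instead of the chosen \<open>frechet_derivative\<close>.\<close>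

lemma times_differentiable_on_SucI:
  assumes "open S" "\<And>x. x \<in> S \<Longrightarrow> (f has_derivative f' x) (at x)"
    and "\<And>v. times_differentiable_on n S (\<lambda>x. f' x v)"
  shows "times_differentiable_on (Suc n) S f"
proof -
  have "frechet_derivative f (at x) = f' x" if "x \<in> S" for x
    using assms(2)[OF that] frechet_derivative_at by metis
  then have "times_differentiable_on n S (\<lambda>x. FD f x v)" for v
    by (intro times_differentiable_on_cong[OF assms(1) assms(3)[of v]]) auto
  then show ?thesis using assms(2) by (auto simp: differentiable_def)
qed

lemma times_differentiable_on_FD:
  "times_differentiable_on (Suc n) S f \<Longrightarrow> times_differentiable_on n S (\<lambda>x. FD f x v)"
  by simp

lemma times_differentiable_on_has_derivative:
  "times_differentiable_on (Suc n) S f \<Longrightarrow> x \<in> S \<Longrightarrow> (f has_derivative FD f x) (at x)"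
  by (auto simp: frechet_derivative_works)

lemma times_differentiable_on_subset:
  "times_differentiable_on n S f \<Longrightarrow> T \<subseteq> S \<Longrightarrow> times_differentiable_on n T f"
  by (induction n arbitrary: f) (auto intro: continuous_on_subset)

lemma times_differentiable_on_SucD:
  "times_differentiable_on (Suc n) S f \<Longrightarrow> times_differentiable_on n S f"
proof (induction n arbitrary: f)
  case 0
  then show ?case
    by (auto simp: continuous_at_imp_continuous_on differentiable_imp_continuous_within)
next
  case (Suc n)
  then show ?case by (metis times_differentiable_on.simps(2))
qed

lemma times_differentiable_on_const: "open S \<Longrightarrow> times_differentiable_on n S (\<lambda>x. c)"
proof (induction n arbitrary: c)
  case (Suc n)
  show ?case
    by (rule times_differentiable_on_SucI[where f'="\<lambda>x v. 0"]) (use Suc in auto)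
qed auto

lemma times_differentiable_on_linear_compose:
  assumes "bounded_linear h" "open S" "times_differentiable_on n S f"
  shows "times_differentiable_on n S (\<lambda>x. h (f x))"
  using assms(3)
proof (induction n arbitrary: f)
  case 0
  then show ?case using bounded_linear.continuous_on[OF assms(1)] by auto
next
  case (Suc n)
  show ?case
  proof (rule times_differentiable_on_SucI[OF \<open>open S\<close>, where f'="\<lambda>x v. h (FD f x v)"])
    fix x assume x: "x \<in> S"
    show "((\<lambda>x. h (f x)) has_derivative (\<lambda>v. h (FD f x v))) (at x)"
      by (intro bounded_linear.has_derivative[OF assms(1)] times_differentiable_on_has_derivative[OF Suc.prems(1)] x)
  next
    fix v show "times_differentiable_on n S (\<lambda>x. h (FD f x v))"
      by (intro Suc.IH times_differentiable_on_FD[OF Suc.prems(1)])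
  qed
qed

lemma times_differentiable_on_bounded_linear:
  assumes "bounded_linear f" "open S"
  shows "times_differentiable_on n S f"
proof (cases n)
  case 0
  then show ?thesis using linear_continuous_on[OF assms(1)] by simp
next
  case (Suc m)
  show ?thesis unfolding Suc
    by (rule times_differentiable_on_SucI[where f'="\<lambda>x v. f v"])
       (use assms bounded_linear_imp_has_derivative times_differentiable_on_const in auto)
qed

lemma times_differentiable_on_add:
  assumes "open S" "times_differentiable_on n S f" "times_differentiable_on n S g"
  shows "times_differentiable_on n S (\<lambda>x. f x + g x)"
  using assms(2,3)
proof (induction n arbitrary: f g)
  case (Suc n)
  show ?case
  proof (rule times_differentiable_on_SucI[OF \<open>open S\<close>, where f'="\<lambda>x v. FD f x v + FD g x v"])
    fix x assume x: "x \<in> S"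
    show "((\<lambda>x. f x + g x) has_derivative (\<lambda>v. FD f x v + FD g x v)) (at x)"
      by (intro has_derivative_add times_differentiable_on_has_derivative[OF Suc.prems(1)] times_differentiable_on_has_derivative[OF Suc.prems(2)] x)
  next
    fix v show "times_differentiable_on n S (\<lambda>x. FD f x v + FD g x v)"
      by (intro Suc.IH times_differentiable_on_FD[OF Suc.prems(1)] times_differentiable_on_FD[OF Suc.prems(2)])
  qed
qed (auto intro: continuous_on_add)

lemma times_differentiable_on_sum:
  assumes "open S" "\<And>i. i \<in> I \<Longrightarrow> times_differentiable_on n S (f i)"
  shows "times_differentiable_on n S (\<lambda>x. \<Sum>i\<in>I. f i x)"
  using assms(2)
  by (induction I rule: infinite_finite_induct)
     (auto intro!: times_differentiable_on_const times_differentiable_on_add \<open>open S\<close>)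

lemma times_differentiable_on_scaleR:
  assumes "open S" "times_differentiable_on n S r" "times_differentiable_on n S f"
  shows "times_differentiable_on n S (\<lambda>x. r x *\<^sub>R f x)"
  using assms(2,3)
proof (induction n arbitrary: r f)
  case (Suc n)
  show ?case
  proof (rule times_differentiable_on_SucI[OF \<open>open S\<close>, where f'="\<lambda>x v. r x *\<^sub>R FD f x v + FD r x v *\<^sub>R f x"])
    fix x assume x: "x \<in> S"
    show "((\<lambda>x. r x *\<^sub>R f x) has_derivative (\<lambda>v. r x *\<^sub>R FD f x v + FD r x v *\<^sub>R f x)) (at x)"
      by (intro has_derivative_scaleR times_differentiable_on_has_derivative[OF Suc.prems(1)] times_differentiable_on_has_derivative[OF Suc.prems(2)] x)
  next
    fix v show "times_differentiable_on n S (\<lambda>x. r x *\<^sub>R FD f x v + FD r x v *\<^sub>R f x)"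
      by (intro times_differentiable_on_add Suc.IH assms(1) times_differentiable_on_FD[OF Suc.prems(1)] times_differentiable_on_FD[OF Suc.prems(2)] times_differentiable_on_SucD[OF Suc.prems(1)] times_differentiable_on_SucD[OF Suc.prems(2)])
  qed
qed (auto intro: continuous_on_scaleR)

lemma times_differentiable_on_Pair:
  assumes "open S" "times_differentiable_on n S f" "times_differentiable_on n S g"
  shows "times_differentiable_on n S (\<lambda>x. (f x, g x))"
  using assms(2,3)
proof (induction n arbitrary: f g)
  case (Suc n)
  show ?case
  proof (rule times_differentiable_on_SucI[OF \<open>open S\<close>, where f'="\<lambda>x v. (FD f x v, FD g x v)"])
    fix x assume x: "x \<in> S"
    show "((\<lambda>x. (f x, g x)) has_derivative (\<lambda>v. (FD f x v, FD g x v))) (at x)"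
      by (intro has_derivative_Pair times_differentiable_on_has_derivative[OF Suc.prems(1)] times_differentiable_on_has_derivative[OF Suc.prems(2)] x)
  next
    fix v show "times_differentiable_on n S (\<lambda>x. (FD f x v, FD g x v))"
      by (intro Suc.IH times_differentiable_on_FD[OF Suc.prems(1)] times_differentiable_on_FD[OF Suc.prems(2)])
  qed
qed (auto intro: continuous_on_Pair)

text \<open>The definition controls derivatives in fixed directions only, whereas the chain rule
  gives \<open>FD f (g x) (FD g x v)\<close>, whose direction moves with \<open>x\<close>. Expanding
  that direction in coordinates leaves a finite sum of products to which the induction hypothesis
  applies; hence the finite dimension of the intermediate space.\<close>

lemma times_differentiable_on_compose:
  fixes g :: "'a::real_normed_vector \<Rightarrow> 'b::real_inner"
  assumes "finite_dim TYPE('b)" "open S" "times_differentiable_on n S g"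
    "times_differentiable_on n T f" "g ` S \<subseteq> T"
  shows "times_differentiable_on n S (\<lambda>x. f (g x))"
  using assms(3,4)
proof (induction n arbitrary: f)
  case 0
  then show ?case using continuous_on_compose2[OF _ _ assms(5)] by simp
next
  case (Suc n)
  obtain B and c where B: "finite B" "\<And>x::'b. x = (\<Sum>b\<in>B. (x \<bullet> c b) *\<^sub>R b)"
    using finite_dim_coordinates[OF assms(1)] by metis
  have f: "(f has_derivative FD f y) (at y)" if "y \<in> T" for y
    using Suc.prems that times_differentiable_on_has_derivative by blast
  have g: "(g has_derivative FD g y) (at y)" if "y \<in> S" for y
    using Suc.prems that times_differentiable_on_has_derivative by blast
  have gn: "times_differentiable_on n S g" using Suc.prems times_differentiable_on_SucD by blast
  have lin: "FD f y v = (\<Sum>b\<in>B. (v \<bullet> c b) *\<^sub>R FD f y b)" if "y \<in> T" for y v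
  proof -
    have "linear (FD f y)" using f[OF that] has_derivative_linear by blast
    then have "FD f y (\<Sum>b\<in>B. (v \<bullet> c b) *\<^sub>R b) = (\<Sum>b\<in>B. (v \<bullet> c b) *\<^sub>R FD f y b)"
      by (simp add: linear_sum linear_scale)
    then show ?thesis unfolding B(2)[symmetric] .
  qed
  show ?case
  proof (rule times_differentiable_on_SucI[OF assms(2), where f'="\<lambda>x v. \<Sum>b\<in>B. (FD g x v \<bullet> c b) *\<^sub>R FD f (g x) b"])
    fix x assume x: "x \<in> S"
    then have gx: "g x \<in> T" using assms(5) by blast
    have "(\<lambda>v. \<Sum>b\<in>B. (FD g x v \<bullet> c b) *\<^sub>R FD f (g x) b) = (\<lambda>v. FD f (g x) (FD g x v))"
      by (rule ext) (rule lin[OF gx, symmetric])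
    then show "((\<lambda>x. f (g x)) has_derivative (\<lambda>v. \<Sum>b\<in>B. (FD g x v \<bullet> c b) *\<^sub>R FD f (g x) b)) (at x)"
      using has_derivative_compose[OF g[OF x] f[OF gx]] by simp
  next
    fix v
    show "times_differentiable_on n S (\<lambda>x. \<Sum>b\<in>B. (FD g x v \<bullet> c b) *\<^sub>R FD f (g x) b)"
      using Suc.prems
      by (intro times_differentiable_on_sum times_differentiable_on_scaleR assms(2) Suc.IH gn
           times_differentiable_on_linear_compose[of "\<lambda>x. x \<bullet> c b" for b] bounded_linear_inner_left) auto
  qed
qed

section \<open>Smooth maps and rules for their directional derivatives\<close>

lemma smooth_on_cong: "open S \<Longrightarrow> smooth_on S f \<Longrightarrow> (\<And>x. x \<in> S \<Longrightarrow> f x = g x) \<Longrightarrow> smooth_on S g"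
  unfolding smooth_on_def using times_differentiable_on_cong by blast

lemma smooth_on_subset: "smooth_on S f \<Longrightarrow> T \<subseteq> S \<Longrightarrow> smooth_on T f"
  unfolding smooth_on_def using times_differentiable_on_subset by blast

lemma smooth_on_const: "open S \<Longrightarrow> smooth_on S (\<lambda>x. c)"
  unfolding smooth_on_def using times_differentiable_on_const by blast

lemma smooth_on_bounded_linear: "bounded_linear f \<Longrightarrow> open S \<Longrightarrow> smooth_on S f"
  unfolding smooth_on_def using times_differentiable_on_bounded_linear by blast

lemma smooth_on_ident: "open S \<Longrightarrow> smooth_on S (\<lambda>x. x)"
  by (rule smooth_on_bounded_linear[OF bounded_linear_ident])

lemma smooth_on_add: "open S \<Longrightarrow> smooth_on S f \<Longrightarrow> smooth_on S g \<Longrightarrow> smooth_on S (\<lambda>x. f x + g x)"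
  unfolding smooth_on_def using times_differentiable_on_add by blast

lemma smooth_on_Pair: "open S \<Longrightarrow> smooth_on S f \<Longrightarrow> smooth_on S g \<Longrightarrow> smooth_on S (\<lambda>x. (f x, g x))"
  unfolding smooth_on_def using times_differentiable_on_Pair by blast

lemma smooth_on_compose:
  fixes g :: "'a::real_normed_vector \<Rightarrow> 'b::real_inner"
  shows "finite_dim TYPE('b) \<Longrightarrow> open S \<Longrightarrow> smooth_on S g \<Longrightarrow> smooth_on T f \<Longrightarrow> g ` S \<subseteq> T
    \<Longrightarrow> smooth_on S (\<lambda>x. f (g x))"
  unfolding smooth_on_def using times_differentiable_on_compose by blast

lemma smooth_on_FD: "smooth_on S f \<Longrightarrow> smooth_on S (\<lambda>x. FD f x v)"
  unfolding smooth_on_def using times_differentiable_on_FD by blast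

lemma smooth_on_has_derivative: "smooth_on S f \<Longrightarrow> x \<in> S \<Longrightarrow> (f has_derivative FD f x) (at x)"
  unfolding smooth_on_def using times_differentiable_on_has_derivative by blast

lemma smooth_on_continuous: "smooth_on S f \<Longrightarrow> continuous_on S f"
  unfolding smooth_on_def using times_differentiable_on.simps(1) by blast

lemma smooth_on_local:
  assumes "\<And>x. x \<in> S \<Longrightarrow> \<exists>W. open W \<and> x \<in> W \<and> smooth_on W f"
  shows "smooth_on S f"
  unfolding smooth_on_def
proof
  fix n
  have "\<And>x. x \<in> S \<Longrightarrow> \<exists>W. open W \<and> x \<in> W \<and> times_differentiable_on n W f"
    using assms unfolding smooth_on_def by blast
  then show "times_differentiable_on n S f"
  proof (induction n arbitrary: f)
    case 0
    then show ?case
      by (metis continuous_at_imp_continuous_on continuous_on_eq_continuous_at times_differentiable_on.simps(1))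
  next
    case (Suc n)
    then show ?case by (metis times_differentiable_on.simps(2))
  qed
qed

lemma FD_eqI: "(f has_derivative f') (at x) \<Longrightarrow> FD f x v = f' v"
  using frechet_derivative_at by metis

text \<open>Both functions have the same derivatives at \<open>x\<close>, so the choice operator
  behind \<open>frechet_derivative\<close> returns the same value, even at a point where no
  derivative exists.\<close>

lemma FD_cong_open:
  assumes "open S" "x \<in> S" "\<And>y. y \<in> S \<Longrightarrow> f y = g y"
  shows "FD f x v = FD g x v"
proof -
  have "(f has_derivative D) (at x) \<longleftrightarrow> (g has_derivative D) (at x)" for D
    using has_derivative_transform_within_open[OF _ assms(1,2)] assms(3) by metis
  then show ?thesis unfolding frechet_derivative_def by presburger
qed

lemma smooth_on_linear: "smooth_on S f \<Longrightarrow> x \<in> S \<Longrightarrow> linear (FD f x)"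
  using smooth_on_has_derivative has_derivative_linear by blast

lemma FD_add: "smooth_on S f \<Longrightarrow> x \<in> S \<Longrightarrow> FD f x (v + w) = FD f x v + FD f x w"
  using smooth_on_linear linear_add by blast

lemma smooth_on_has_vector_derivative_compose:
  assumes "smooth_on S f" "\<gamma> t \<in> S" "(\<gamma> has_vector_derivative v) (at t within T)"
  shows "((\<lambda>t. f (\<gamma> t)) has_vector_derivative FD f (\<gamma> t) v) (at t within T)"
proof -
  note D = smooth_on_has_derivative[OF assms(1,2)]
  have "((\<lambda>t. f (\<gamma> t)) has_derivative (\<lambda>h. FD f (\<gamma> t) (h *\<^sub>R v))) (at t within T)"
    using has_derivative_compose[where g=f and f=\<gamma>, OF _ D] assms(3) unfolding has_vector_derivative_def by blast
  then show ?thesis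
    unfolding has_vector_derivative_def using linear_scale[OF has_derivative_linear[OF D]] by simp
qed

lemma FD_compose:
  assumes "smooth_on S f" "g x \<in> S" "(g has_derivative g') (at x)"
  shows "FD (\<lambda>x. f (g x)) x v = FD f (g x) (g' v)"
  using has_derivative_compose[OF assms(3) smooth_on_has_derivative[OF assms(1,2)]] by (rule FD_eqI)

text \<open>Differentiating \<open>f(s, t) = f(s, 0) + \<integral> f\<^sub>t(s, \<sigma>) d\<sigma>\<close> under the integral sign, first in \<open>s\<close> and then in \<open>t\<close>.\<close>

lemma FD_commute:
  fixes f :: "'a::real_normed_vector \<Rightarrow> 'b::banach"
  assumes S: "open S" "x \<in> S" and f: "smooth_on S f"
  shows "FD (\<lambda>y. FD f y v) x w = FD (\<lambda>y. FD f y w) x v"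
proof -
  define p where "p = (\<lambda>(s::real, t::real). x + s *\<^sub>R v + t *\<^sub>R w)"
  have "continuous_on UNIV p" unfolding p_def split_def by (intro continuous_intros)
  then have "open (p -` S)" using S(1) by (simp add: open_vimage continuous_on_open_vimage)
  moreover have "(0,0) \<in> p -` S" using S by (auto simp: p_def)
  ultimately obtain A B where AB: "open A" "open B" "0 \<in> A" "0 \<in> B" "A \<times> B \<subseteq> p -` S"
    by (auto elim!: open_prod_elim)
  obtain r1 where r1: "r1 > 0" "cball 0 r1 \<subseteq> A" using AB open_contains_cball by blast
  obtain r2 where r2: "r2 > 0" "cball 0 r2 \<subseteq> B" using AB open_contains_cball by blast
  \<comment> \<open>The parameter \<open>s\<close> runs over a convex neighbourhood of 0, as the
    Leibniz rule requires; \<open>t\<close> runs over \<open>{0..r2}\<close> because the integral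
    starts at 0.\<close>
  define U where "U = cball (0::real) r1"
  have pS: "x + s *\<^sub>R v + t *\<^sub>R w \<in> S" if "s \<in> U" "t \<in> {0..r2}" for s t
    using that r1 r2 AB(5) unfolding U_def p_def by (fastforce simp: dist_real_def subset_iff)
  have dt: "((\<lambda>t. h (x + s *\<^sub>R v + t *\<^sub>R w)) has_vector_derivative FD h (x + s *\<^sub>R v + t *\<^sub>R w) w) (at t within T)"
    if "smooth_on S h" "s \<in> U" "t \<in> {0..r2}" for h :: "'a \<Rightarrow> 'b" and s t T
    by (rule smooth_on_has_vector_derivative_compose[OF that(1)])
       (use pS that in \<open>auto intro!: derivative_eq_intros\<close>)
  have ds: "((\<lambda>s. h (x + s *\<^sub>R v + t *\<^sub>R w)) has_vector_derivative FD h (x + s *\<^sub>R v + t *\<^sub>R w) v) (at s within T)"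
    if "smooth_on S h" "s \<in> U" "t \<in> {0..r2}" for h :: "'a \<Rightarrow> 'b" and s t T
    by (rule smooth_on_has_vector_derivative_compose[OF that(1)])
       (use pS that in \<open>auto intro!: derivative_eq_intros\<close>)
  define A where "A = (\<lambda>y. FD f y w)"
  define C where "C = (\<lambda>y. FD A y v)"
  have A: "smooth_on S A" and C: "smooth_on S C" unfolding A_def C_def by (intro smooth_on_FD f)+
  have cont: "continuous_on (U \<times> {0..r2}) (\<lambda>(s, t). h (x + s *\<^sub>R v + t *\<^sub>R w))" if "smooth_on S h" for h :: "'a \<Rightarrow> 'b"
    unfolding split_def
    by (rule continuous_on_compose2[OF smooth_on_continuous[OF that]])
       (use pS in \<open>auto intro!: continuous_intros\<close>)
  have cont1: "continuous_on {0..t} (\<lambda>t. h (x + s *\<^sub>R v + t *\<^sub>R w))"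
    if "smooth_on S h" "s \<in> U" "t \<in> {0..r2}" for h :: "'a \<Rightarrow> 'b" and s t
    by (rule continuous_on_compose2[OF smooth_on_continuous[OF that(1)]])
       (use pS that in \<open>auto intro!: continuous_intros\<close>)
  have ftc: "f (x + s *\<^sub>R v + t *\<^sub>R w) = f (x + s *\<^sub>R v) + integral {0..t} (\<lambda>t. A (x + s *\<^sub>R v + t *\<^sub>R w))"
    if "s \<in> U" "t \<in> {0..r2}" for s t
    using fundamental_theorem_of_calculus[of 0 t "\<lambda>t. f (x + s *\<^sub>R v + t *\<^sub>R w)" "\<lambda>t. A (x + s *\<^sub>R v + t *\<^sub>R w)"]
      dt[OF f that(1)] that unfolding A_def by (force dest!: integral_unique)
  have 0: "0 \<in> U" using r1 by (auto simp: U_def)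
  have key: "FD f (x + t *\<^sub>R w) v = FD f x v + integral {0..t} (\<lambda>t. C (x + t *\<^sub>R w))"
    if t: "t \<in> {0..r2}" for t
  proof -
    have cC: "continuous_on (U \<times> cbox 0 t) (\<lambda>(s, t). C (x + s *\<^sub>R v + t *\<^sub>R w))"
      by (rule continuous_on_subset[OF cont[OF C]]) (use t in auto)
    have L: "((\<lambda>s. integral (cbox 0 t) (\<lambda>t. A (x + s *\<^sub>R v + t *\<^sub>R w))) has_vector_derivative
        integral (cbox 0 t) (\<lambda>t. C (x + 0 *\<^sub>R v + t *\<^sub>R w))) (at 0 within U)"
      by (rule leibniz_rule_vector_derivative[OF _ _ cC])
         (use t 0 ds[OF A] cont1[OF A] in
           \<open>auto simp: C_def U_def intro!: integrable_continuous_real\<close>)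
    have "((\<lambda>s. f (x + s *\<^sub>R v) + integral {0..t} (\<lambda>t. A (x + s *\<^sub>R v + t *\<^sub>R w)))
       has_vector_derivative (FD f x v + integral {0..t} (\<lambda>t. C (x + t *\<^sub>R w)))) (at 0 within U)"
      using has_vector_derivative_add[OF ds[OF f 0, of 0 U] L] r2 by simp
    then have "((\<lambda>s. f (x + s *\<^sub>R v + t *\<^sub>R w)) has_vector_derivative
        (FD f x v + integral {0..t} (\<lambda>t. C (x + t *\<^sub>R w)))) (at 0 within U)"
      by (rule has_vector_derivative_transform[OF 0, rotated]) (use ftc t in simp)
    moreover have "((\<lambda>s. f (x + s *\<^sub>R v + t *\<^sub>R w)) has_vector_derivative FD f (x + t *\<^sub>R w) v) (at 0 within U)"
      using ds[OF f 0 t] by simp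
    ultimately show ?thesis
      using r1 vector_derivative_unique_within_closed_interval[of "-r1" r1 0]
      by (auto simp: U_def cball_eq_atLeastAtMost)
  qed
  have 00: "0 \<in> {0..r2}" using r2 by auto
  \<comment> \<open>The one-sided derivative at 0 of the same function of \<open>t\<close> is
    computed directly and from the integral formula \<open>key\<close>; the two results are the two
    mixed derivatives.\<close>
  have "((\<lambda>t. FD f (x + t *\<^sub>R w) v) has_vector_derivative FD (\<lambda>y. FD f y v) x w) (at 0 within {0..r2})"
    using dt[OF smooth_on_FD[OF f, of v] 0 00] by simp
  moreover have "((\<lambda>t. FD f (x + t *\<^sub>R w) v) has_vector_derivative C x) (at 0 within {0..r2})"
  proof (rule has_vector_derivative_transform[OF 00])
    have "((\<lambda>t. integral {0..t} (\<lambda>t. C (x + t *\<^sub>R w))) has_vector_derivative C (x + 0 *\<^sub>R w)) (at 0 within {0..r2})"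
      by (rule integral_has_vector_derivative) (use cont1[OF C 0, of r2] 00 in auto)
    from has_vector_derivative_add[OF has_vector_derivative_const[of "FD f x v"] this]
    show "((\<lambda>t. FD f x v + integral {0..t} (\<lambda>t. C (x + t *\<^sub>R w))) has_vector_derivative C x) (at 0 within {0..r2})"
      by simp
  qed (use key in auto)
  ultimately show ?thesis
    using vector_derivative_unique_within_closed_interval[OF r2(1), of 0] 00
    unfolding C_def A_def by auto
qed

section \<open>Smooth maps from a vector space into a manifold\<close>

text \<open>In contrast to \<open>smooth_map_on\<close> on a non-open set, \<open>K\<close> itself, not merely an extension, is smooth around \<open>p\<close>.\<close>

definition smooth_map_at ::
  "('q::topological_space, 'e::real_normed_vector) atlas \<Rightarrow> ('a::real_normed_vector \<Rightarrow> 'q) \<Rightarrow> 'a \<Rightarrow> bool"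
where
  "smooth_map_at A K p \<longleftrightarrow>
     (\<exists>(V, \<psi>)\<in>A. \<exists>W. open W \<and> p \<in> W \<and> K ` W \<subseteq> V \<and> smooth_on W (\<lambda>q. \<psi> (K q)))"

lemma smooth_map_atE:
  assumes "smooth_map_at A K p"
  obtains V \<psi> W where "(V, \<psi>) \<in> A" "open W" "p \<in> W" "K ` W \<subseteq> V" "smooth_on W (\<lambda>q. \<psi> (K q))"
  using assms unfolding smooth_map_at_def by blast

lemma smooth_map_atI:
  "(V, \<psi>) \<in> A \<Longrightarrow> open W \<Longrightarrow> p \<in> W \<Longrightarrow> K ` W \<subseteq> V \<Longrightarrow> smooth_on W (\<lambda>q. \<psi> (K q)) \<Longrightarrow> smooth_map_at A K p"
  unfolding smooth_map_at_def by blast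

lemma smooth_map_at_cong:
  assumes "smooth_map_at A K p" "open N" "p \<in> N" "\<And>q. q \<in> N \<Longrightarrow> K q = K' q"
  shows "smooth_map_at A K' p"
proof -
  obtain V \<psi> W where W: "(V, \<psi>) \<in> A" "open W" "p \<in> W" "K ` W \<subseteq> V" "smooth_on W (\<lambda>q. \<psi> (K q))"
    using assms(1) by (rule smooth_map_atE)
  show ?thesis
  proof (rule smooth_map_atI[OF W(1), where W="W \<inter> N"])
    show "smooth_on (W \<inter> N) (\<lambda>q. \<psi> (K' q))"
      by (rule smooth_on_cong[OF _ smooth_on_subset[OF W(5)]]) (use W assms in auto)
  qed (use W assms in \<open>auto simp flip: assms(4)\<close>)
qed

lemma smooth_map_onE:
  assumes "smooth_map_on A B S f" "p \<in> S"
  obtains U \<phi> V \<psi> W F where "(U, \<phi>) \<in> A" "(V, \<psi>) \<in> B" "open W" "p \<in> W" "W \<subseteq> U"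
    "f ` (W \<inter> S) \<subseteq> V" "smooth_on (\<phi> ` W) F" "\<forall>q\<in>W \<inter> S. \<psi> (f q) = F (\<phi> q)"
proof -
  obtain c where c: "c \<in> A" "case c of (U, \<phi>) \<Rightarrow> \<exists>(V, \<psi>)\<in>B. \<exists>W F. open W \<and> p \<in> W \<and> W \<subseteq> U \<and>
        f ` (W \<inter> S) \<subseteq> V \<and> smooth_on (\<phi> ` W) F \<and> (\<forall>q\<in>W \<inter> S. \<psi> (f q) = F (\<phi> q))"
    using bspec[OF assms(1)[unfolded smooth_map_on_def] assms(2)] by (rule bexE)
  obtain U \<phi> where U: "c = (U, \<phi>)" by (cases c)
  obtain d where d: "d \<in> B" "case d of (V, \<psi>) \<Rightarrow> \<exists>W F. open W \<and> p \<in> W \<and> W \<subseteq> U \<and>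
        f ` (W \<inter> S) \<subseteq> V \<and> smooth_on (\<phi> ` W) F \<and> (\<forall>q\<in>W \<inter> S. \<psi> (f q) = F (\<phi> q))"
    using c(2)[unfolded U prod.case] by (rule bexE)
  obtain V \<psi> where V: "d = (V, \<psi>)" by (cases d)
  show thesis using d(2)[unfolded V prod.case] that[OF c(1)[unfolded U] d(1)[unfolded V]] by blast
qed

text \<open>On an open set the smooth local extension coincides with the coordinate expression
  itself near each point.\<close>

lemma smooth_map_on_vec_iff:
  assumes "open \<Omega>"
  shows "smooth_map_on vec_atlas A \<Omega> K \<longleftrightarrow> (\<forall>p\<in>\<Omega>. smooth_map_at A K p)"
proof
  assume L: "smooth_map_on vec_atlas A \<Omega> K"
  show "\<forall>p\<in>\<Omega>. smooth_map_at A K p"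
  proof
    fix p assume "p \<in> \<Omega>"
    with L obtain U \<phi> V \<psi> W F where U: "(U, \<phi>) \<in> vec_atlas"
      and W: "(V, \<psi>) \<in> A" "open W" "p \<in> W" "W \<subseteq> U"
      "K ` (W \<inter> \<Omega>) \<subseteq> V" "smooth_on (\<phi> ` W) F" "\<forall>q\<in>W \<inter> \<Omega>. \<psi> (K q) = F (\<phi> q)"
      by (rule smooth_map_onE)
    have \<phi>: "\<phi> = id" using U unfolding vec_atlas_def by simp
    have F: "smooth_on W F" using W(6) unfolding \<phi> by simp
    have "smooth_on (W \<inter> \<Omega>) (\<lambda>q. \<psi> (K q))"
      by (rule smooth_on_cong[OF _ smooth_on_subset[OF F]]) (use W assms \<phi> in auto)
    then show "smooth_map_at A K p"
      using W assms \<open>p \<in> \<Omega>\<close> by (intro smooth_map_atI[OF W(1), where W="W \<inter> \<Omega>"]) auto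
  qed
next
  assume R: "\<forall>p\<in>\<Omega>. smooth_map_at A K p"
  show "smooth_map_on vec_atlas A \<Omega> K"
    unfolding smooth_map_on_def
  proof
    fix p assume "p \<in> \<Omega>"
    then obtain V \<psi> W where W: "(V, \<psi>) \<in> A" "open W" "p \<in> W" "K ` W \<subseteq> V" "smooth_on W (\<lambda>q. \<psi> (K q))"
      using R smooth_map_atE by metis
    then have "open W \<and> p \<in> W \<and> W \<subseteq> UNIV \<and> K ` (W \<inter> \<Omega>) \<subseteq> V \<and> smooth_on (id ` W) (\<lambda>q. \<psi> (K q)) \<and>
      (\<forall>q\<in>W \<inter> \<Omega>. \<psi> (K q) = (\<lambda>q. \<psi> (K q)) (id q))" by auto
    then have "\<exists>W F. open W \<and> p \<in> W \<and> W \<subseteq> UNIV \<and> K ` (W \<inter> \<Omega>) \<subseteq> V \<and> smooth_on (id ` W) F \<and>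
      (\<forall>q\<in>W \<inter> \<Omega>. \<psi> (K q) = F (id q))" by blast
    then show "\<exists>(U, \<phi>)\<in>vec_atlas. \<exists>(V, \<psi>)\<in>A. \<exists>W F. open W \<and> p \<in> W \<and> W \<subseteq> U \<and> K ` (W \<inter> \<Omega>) \<subseteq> V \<and>
        smooth_on (\<phi> ` W) F \<and> (\<forall>q\<in>W \<inter> \<Omega>. \<psi> (K q) = F (\<phi> q))"
      using W(1) unfolding vec_atlas_def by blast
  qed
qed

section \<open>Change of charts and composition of smooth maps\<close>

lemma smooth_atlas_chart:
  assumes "smooth_atlas A" "(U, \<phi>) \<in> A"
  shows "open U" "open (\<phi> ` U)" "homeomorphism U (\<phi> ` U) \<phi> (inv_into U \<phi>)" "inj_on \<phi> U"
proof -
  show "open U" "open (\<phi> ` U)" "homeomorphism U (\<phi> ` U) \<phi> (inv_into U \<phi>)"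
    using assms unfolding smooth_atlas_def by blast+
  then show "inj_on \<phi> U" by (metis homeomorphism_apply1 inj_on_inverseI)
qed

lemma smooth_atlas_transition:
  assumes "smooth_atlas A" "(U, \<phi>) \<in> A" "(V, \<psi>) \<in> A"
  shows "smooth_on (\<phi> ` (U \<inter> V)) (\<lambda>x. \<psi> (inv_into U \<phi> x))"
  using assms unfolding smooth_atlas_def comp_def by blast

lemma smooth_atlas_cover:
  assumes "smooth_atlas A"
  obtains U \<phi> where "(U, \<phi>) \<in> A" "x \<in> U"
proof -
  have "x \<in> (\<Union>(U, \<phi>)\<in>A. U)" using assms unfolding smooth_atlas_def by simp
  then show thesis using that by auto
qed

text \<open>Independence of the chart: the coordinate expression in the chart that witnesses
  smoothness is composed with a transition map. Continuity of \<open>K\<close>, read off in the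
  first chart, provides the open set on which \<open>K\<close> stays in \<open>U\<close>.\<close>

lemma smooth_map_at_chart:
  fixes A :: "('q::topological_space, 'e::real_inner) atlas"
  assumes A: "smooth_atlas A" "finite_dim TYPE('e)" and K: "smooth_map_at A K p"
    and U: "(U, \<phi>) \<in> A" "K p \<in> U"
  obtains W where "open W" "p \<in> W" "K ` W \<subseteq> U" "smooth_on W (\<lambda>q. \<phi> (K q))" "continuous_on W K"
proof -
  obtain V \<psi> W where W: "(V, \<psi>) \<in> A" "open W" "p \<in> W" "K ` W \<subseteq> V" "smooth_on W (\<lambda>q. \<psi> (K q))"
    using K by (rule smooth_map_atE)
  note V = smooth_atlas_chart[OF A(1) W(1)]
  have "continuous_on W (\<lambda>q. inv_into V \<psi> (\<psi> (K q)))"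
    by (rule continuous_on_compose2[OF homeomorphism_cont2[OF V(3)] smooth_on_continuous[OF W(5)]])
       (use W in auto)
  then have cont: "continuous_on W K"
    using W(4) V(4) by (subst continuous_on_cong[OF refl, of _ _ "\<lambda>q. inv_into V \<psi> (\<psi> (K q))"]) auto
  define N where "N = W \<inter> K -` U"
  have N: "open N" unfolding N_def
    using continuous_open_preimage[OF cont W(2) smooth_atlas_chart(1)[OF A(1) U(1)]] by simp
  have "smooth_on N (\<lambda>q. \<phi> (inv_into V \<psi> (\<psi> (K q))))"
    by (rule smooth_on_compose[OF A(2) N smooth_on_subset[OF W(5)] smooth_atlas_transition[OF A(1) W(1) U(1)]])
       (use W in \<open>auto simp: N_def\<close>)
  then have "smooth_on N (\<lambda>q. \<phi> (K q))"
    by (rule smooth_on_cong[OF N]) (use W(4) V(4) in \<open>auto simp: N_def\<close>)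
  then show thesis
    using that[OF N] W(3) U(2) continuous_on_subset[OF cont] unfolding N_def by blast
qed

lemma smooth_map_at_inv_chart:
  assumes "smooth_atlas A" "(U, \<phi>) \<in> A" "open W" "p \<in> W" "smooth_on W F" "F ` W \<subseteq> \<phi> ` U"
  shows "smooth_map_at A (\<lambda>q. inv_into U \<phi> (F q)) p"
proof (rule smooth_map_atI[OF assms(2-4)])
  show "(\<lambda>q. inv_into U \<phi> (F q)) ` W \<subseteq> U" using assms(6) inv_into_into[of _ \<phi> U] by blast
  show "smooth_on W (\<lambda>q. \<phi> (inv_into U \<phi> (F q)))"
    by (rule smooth_on_cong[OF assms(3,5)]) (use assms(6) in \<open>auto simp: f_inv_into_f\<close>)
qed

lemma smooth_map_at_const:
  assumes "smooth_atlas A"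
  shows "smooth_map_at A (\<lambda>q. x) p"
proof -
  obtain U \<phi> where "(U, \<phi>) \<in> A" "x \<in> U" using smooth_atlas_cover[OF assms] by blast
  then show ?thesis by (intro smooth_map_atI[where W=UNIV]) (auto intro: smooth_on_const)
qed

lemma smooth_map_at_compose:
  fixes F :: "'a::real_normed_vector \<Rightarrow> 'b::real_inner"
  assumes b: "finite_dim TYPE('b)" and K: "smooth_map_at A K (F p)"
    and F: "open W" "p \<in> W" "smooth_on W F"
  shows "smooth_map_at A (\<lambda>q. K (F q)) p"
proof -
  obtain V \<psi> W' where W': "(V, \<psi>) \<in> A" "open W'" "F p \<in> W'" "K ` W' \<subseteq> V" "smooth_on W' (\<lambda>q. \<psi> (K q))"
    using K by (rule smooth_map_atE)
  have N: "open (W \<inter> F -` W')"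
    using continuous_open_preimage[OF smooth_on_continuous[OF F(3)] F(1) W'(2)] by simp
  show ?thesis
  proof (rule smooth_map_atI[OF W'(1) N])
    show "smooth_on (W \<inter> F -` W') (\<lambda>q. \<psi> (K (F q)))"
      by (rule smooth_on_compose[OF b N smooth_on_subset[OF F(3)] W'(5)]) auto
  qed (use W' F in auto)
qed

lemma smooth_map_at_linear_compose:
  fixes F :: "'a::real_normed_vector \<Rightarrow> 'b::real_inner"
  assumes "finite_dim TYPE('b)" "smooth_map_at A K (F p)" "bounded_linear F"
  shows "smooth_map_at A (\<lambda>q. K (F q)) p"
  by (rule smooth_map_at_compose[OF assms(1,2) open_UNIV UNIV_I smooth_on_bounded_linear[OF assms(3) open_UNIV]])

lemma smooth_map_at_map1:
  fixes A :: "('p::topological_space, 'e::real_inner) atlas" and p :: "'a::real_normed_vector"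
  assumes A: "smooth_atlas A" "finite_dim TYPE('e)"
    and f: "smooth_map_on A C UNIV f" and K: "smooth_map_at A K p"
  shows "smooth_map_at C (\<lambda>q. f (K q)) p"
proof -
  obtain U \<phi> V \<psi> W F where U: "(U, \<phi>) \<in> A" "(V, \<psi>) \<in> C" "open W" "K p \<in> W" "W \<subseteq> U"
    "f ` W \<subseteq> V" "smooth_on (\<phi> ` W) F" "\<forall>q\<in>W. \<psi> (f q) = F (\<phi> q)"
    using smooth_map_onE[OF f UNIV_I] by (metis Int_UNIV_right)
  obtain W1 where W1: "open W1" "p \<in> W1" "K ` W1 \<subseteq> U" "smooth_on W1 (\<lambda>q. \<phi> (K q))" "continuous_on W1 K"
    using smooth_map_at_chart[OF A K U(1)] U(4,5) by blast
  define N where "N = W1 \<inter> K -` W"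
  have N: "open N" unfolding N_def using continuous_open_preimage[OF W1(5,1) U(3)] by simp
  have "smooth_on N (\<lambda>q. F (\<phi> (K q)))"
    by (rule smooth_on_compose[OF A(2) N smooth_on_subset[OF W1(4)] U(7)]) (auto simp: N_def)
  then have "smooth_on N (\<lambda>q. \<psi> (f (K q)))"
    by (rule smooth_on_cong[OF N]) (use U(8) in \<open>auto simp: N_def\<close>)
  then show ?thesis
    using U W1 by (intro smooth_map_atI[OF U(2) N]) (auto simp: N_def)
qed

text \<open>Covers both the group multiplication and the action. The charts are dictated by the
  local representative of \<open>f\<close>, so \<open>K\<close> and \<open>M\<close> are first
  re-expressed in them.\<close>

lemma smooth_map_at_map2:
  fixes A :: "('p::topological_space, 'e::real_inner) atlas"
    and B :: "('q::topological_space, 'f::real_inner) atlas"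
    and p :: "'a::real_normed_vector"
  assumes A: "smooth_atlas A" "finite_dim TYPE('e)" and B: "smooth_atlas B" "finite_dim TYPE('f)"
    and f: "smooth_map_on (prod_atlas A B) C UNIV (\<lambda>(x, y). f x y)"
    and K: "smooth_map_at A K p" and M: "smooth_map_at B M p"
  shows "smooth_map_at C (\<lambda>q. f (K q) (M q)) p"
proof -
  obtain U \<phi> V \<psi> W F where U': "(U, \<phi>) \<in> prod_atlas A B" "(V, \<psi>) \<in> C" "open W" "(K p, M p) \<in> W"
    "W \<subseteq> U" "(\<lambda>(x, y). f x y) ` W \<subseteq> V" "smooth_on (\<phi> ` W) F"
    "\<forall>q\<in>W. \<psi> ((\<lambda>(x, y). f x y) q) = F (\<phi> q)"
    using smooth_map_onE[OF f UNIV_I] by (metis Int_UNIV_right)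
  obtain U1 \<phi>1 U2 \<phi>2 where U'': "(U1, \<phi>1) \<in> A" "(U2, \<phi>2) \<in> B" "U = U1 \<times> U2" "\<phi> = map_prod \<phi>1 \<phi>2"
    using U'(1) unfolding prod_atlas_def by auto
  note U = U''(1,2) U'(2-8)[unfolded U''(3,4)]
  obtain W1 where W1: "open W1" "p \<in> W1" "K ` W1 \<subseteq> U1" "smooth_on W1 (\<lambda>q. \<phi>1 (K q))" "continuous_on W1 K"
    using smooth_map_at_chart[OF A K U(1)] U(5,6) by blast
  obtain W2 where W2: "open W2" "p \<in> W2" "M ` W2 \<subseteq> U2" "smooth_on W2 (\<lambda>q. \<phi>2 (M q))" "continuous_on W2 M"
    using smooth_map_at_chart[OF B M U(2)] U(5,6) by blast
  define N where "N = W1 \<inter> W2 \<inter> (\<lambda>q. (K q, M q)) -` W"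
  have "continuous_on (W1 \<inter> W2) (\<lambda>q. (K q, M q))"
    by (intro continuous_on_Pair continuous_on_subset[OF W1(5)] continuous_on_subset[OF W2(5)]) auto
  then have N: "open N" unfolding N_def
    using continuous_open_preimage[OF _ open_Int[OF W1(1) W2(1)] U(4)] by simp
  have "smooth_on N (\<lambda>q. F (\<phi>1 (K q), \<phi>2 (M q)))"
    by (rule smooth_on_compose[OF finite_dim_prod[OF A(2) B(2)] N _ U(8)])
       (force simp: N_def intro!: smooth_on_Pair N[unfolded N_def] smooth_on_subset[OF W1(4)]
          smooth_on_subset[OF W2(4)])+
  then have "smooth_on N (\<lambda>q. \<psi> (f (K q) (M q)))"
    by (rule smooth_on_cong[OF N]) (use U(9) in \<open>auto simp: N_def\<close>)
  then show ?thesis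
    using U(5,7) W1(2) W2(2) by (intro smooth_map_atI[OF U(3) N]) (auto simp: N_def)
qed

section \<open>The left Maurer--Cartan form\<close>

locale Lie =
  fixes G :: "('g::{t2_space, second_countable_topology}, 'e::{real_inner, banach}) lie_data"
  assumes lie: "lie_group G"
begin

abbreviation "smooth_at \<equiv> smooth_map_at (charts G)"
abbreviation "\<phi> \<equiv> unit_chart G"
abbreviation gone ("\<one>") where "\<one> \<equiv> neutral G"
abbreviation gmul (infixl "\<odot>" 70) where "gmul \<equiv> mul G"
abbreviation ginv where "ginv \<equiv> inver G"

sublocale grp: group "mul G" "neutral G" "inver G"
  using lie unfolding lie_group_def by blast

lemma fd: "finite_dim TYPE('e)" and atl: "smooth_atlas (charts G)"
  using lie unfolding lie_group_def finite_dim_def by blast+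

text \<open>\<open>unit_chart\<close> fixes only a coordinate map, so a chart domain around the
  identity that belongs to it is chosen separately.\<close>

definition U0 where "U0 = (SOME U. (U, \<phi>) \<in> charts G \<and> \<one> \<in> U)"
abbreviation "\<phi>i \<equiv> inv_into U0 \<phi>"
abbreviation "x0 \<equiv> \<phi> \<one>"

lemma U0: "(U0, \<phi>) \<in> charts G" "\<one> \<in> U0"
proof -
  have "\<exists>\<phi>. \<exists>U. (U, \<phi>) \<in> charts G \<and> \<one> \<in> U"
    using smooth_atlas_cover[OF atl] by metis
  then have "\<exists>U. (U, \<phi>) \<in> charts G \<and> \<one> \<in> U"
    unfolding unit_chart_def by (rule someI_ex)
  then have "(U0, \<phi>) \<in> charts G \<and> \<one> \<in> U0" unfolding U0_def by (rule someI_ex)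
  then show "(U0, \<phi>) \<in> charts G" "\<one> \<in> U0" by auto
qed

lemmas U0_chart = smooth_atlas_chart[OF atl U0(1)]

lemma x0: "x0 \<in> \<phi> ` U0" and \<phi>i_x0: "\<phi>i x0 = \<one>"
  using U0 U0_chart(4) by auto

lemma \<phi>_\<phi>i: "y \<in> \<phi> ` U0 \<Longrightarrow> \<phi> (\<phi>i y) = y" and \<phi>i_\<phi>: "x \<in> U0 \<Longrightarrow> \<phi>i (\<phi> x) = x"
  using U0_chart(4) by (auto simp: f_inv_into_f)

lemma smooth_at_\<phi>i: "y \<in> \<phi> ` U0 \<Longrightarrow> smooth_at \<phi>i y"
  using smooth_map_at_inv_chart[OF atl U0(1) U0_chart(2), of y "\<lambda>x. x"]
    smooth_on_bounded_linear[OF bounded_linear_ident U0_chart(2)] by simp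

lemma smooth_at_mul:
  fixes p :: "'a::real_normed_vector"
  shows "smooth_at K p \<Longrightarrow> smooth_at M p \<Longrightarrow> smooth_at (\<lambda>q. K q \<odot> M q) p"
  using lie smooth_map_at_map2[OF atl fd atl fd, of "charts G" gmul] unfolding lie_group_def by blast

lemma smooth_at_inv:
  fixes p :: "'a::real_normed_vector"
  shows "smooth_at K p \<Longrightarrow> smooth_at (\<lambda>q. ginv (K q)) p"
  using lie smooth_map_at_map1[OF atl fd, of "charts G" ginv] unfolding lie_group_def by blast

lemmas smooth_at_const = smooth_map_at_const[OF atl]

lemma smooth_at_\<phi>:
  assumes "smooth_at K p" "K p \<in> U0"
  obtains W where "open W" "p \<in> W" "K ` W \<subseteq> U0" "smooth_on W (\<lambda>q. \<phi> (K q))"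
  using smooth_map_at_chart[OF atl fd assms(1) U0(1) assms(2)] by metis

text \<open>The pullback by \<open>K\<close> of the left Maurer--Cartan form: the vector $K(p)^{-1}\,dK(p)\,v$.\<close>

definition lform :: "('a::real_normed_vector \<Rightarrow> 'g) \<Rightarrow> 'a \<Rightarrow> 'a \<Rightarrow> 'e" where
  "lform K p v = FD (\<lambda>q. \<phi> (ginv (K p) \<odot> K q)) p v"

text \<open>The map \<open>(x, y) \<mapsto> ginv (K x) \<odot> K y\<close> sends the diagonal to the
  identity and therefore stays in the unit chart near \<open>(p, p)\<close>.\<close>

lemma lform_nhd:
  fixes K :: "'a::real_inner \<Rightarrow> 'g"
  assumes "finite_dim TYPE('a)" "smooth_at K p"
  obtains W where "open W" "p \<in> W" "\<And>x y. x \<in> W \<Longrightarrow> y \<in> W \<Longrightarrow> ginv (K x) \<odot> K y \<in> U0"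
    "smooth_on (W \<times> W) (\<lambda>(x, y). \<phi> (ginv (K x) \<odot> K y))"
proof -
  have "smooth_at (\<lambda>z. ginv (K (fst z)) \<odot> K (snd z)) (p, p)"
    using assms(2)
    by (intro smooth_at_mul smooth_at_inv smooth_map_at_linear_compose[OF assms(1) _ bounded_linear_fst]
          smooth_map_at_linear_compose[OF assms(1) _ bounded_linear_snd]) auto
  then obtain V where V: "open V" "(p, p) \<in> V" "(\<lambda>z. ginv (K (fst z)) \<odot> K (snd z)) ` V \<subseteq> U0"
     "smooth_on V (\<lambda>z. \<phi> (ginv (K (fst z)) \<odot> K (snd z)))"
    using U0(2) by (elim smooth_at_\<phi>) auto
  obtain A B where AB: "open A" "open B" "p \<in> A" "p \<in> B" "A \<times> B \<subseteq> V"
    using open_prod_elim[OF V(1,2)] by (metis mem_Sigma_iff)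
  show thesis
  proof
    show "open (A \<inter> B)" "p \<in> A \<inter> B" using AB by auto
    show "ginv (K x) \<odot> K y \<in> U0" if "x \<in> A \<inter> B" "y \<in> A \<inter> B" for x y using that AB V(3) by force
    show "smooth_on ((A \<inter> B) \<times> (A \<inter> B)) (\<lambda>(x, y). \<phi> (ginv (K x) \<odot> K y))"
      unfolding split_def by (rule smooth_on_subset[OF V(4)]) (use AB in auto)
  qed
qed

text \<open>The translation \<open>ginv (K x)\<close> in \<open>lform\<close> changes with the base
  point. Seen as a partial derivative of one smooth two-variable function on the diagonal,
  \<open>lform\<close> becomes smooth in \<open>x\<close>.\<close>

lemma lform_eq_FD2:
  fixes K :: "'a::real_inner \<Rightarrow> 'g"
  assumes "smooth_on (W \<times> W) (\<lambda>(x, y). \<phi> (ginv (K x) \<odot> K y))" "x \<in> W"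
  shows "lform K x v = FD (\<lambda>(x, y). \<phi> (ginv (K x) \<odot> K y)) (x, x) (0, v)"
proof -
  have "FD (\<lambda>q. (\<lambda>(x, y). \<phi> (ginv (K x) \<odot> K y)) (x, q)) x v = FD (\<lambda>(x, y). \<phi> (ginv (K x) \<odot> K y)) (x, x) (0, v)"
    by (rule FD_compose[OF assms(1)]) (use assms(2) in \<open>auto intro!: derivative_eq_intros\<close>)
  then show ?thesis unfolding lform_def by simp
qed

lemma lform_smooth:
  fixes K :: "'a::real_inner \<Rightarrow> 'g"
  assumes fda: "finite_dim TYPE('a)" and K: "\<And>p. p \<in> \<Omega> \<Longrightarrow> smooth_at K p"
  shows "smooth_on \<Omega> (\<lambda>p. lform K p v)"
proof (rule smooth_on_local)
  fix p assume "p \<in> \<Omega>"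
  from lform_nhd[OF fda K[OF this]] obtain W where
    W: "open W" "p \<in> W" "smooth_on (W \<times> W) (\<lambda>(x, y). \<phi> (ginv (K x) \<odot> K y))" by metis
  have d: "smooth_on W (\<lambda>x. (x, x))"
    by (rule smooth_on_bounded_linear[OF _ W(1)]) (intro bounded_linear_Pair bounded_linear_ident)
  have "smooth_on W (\<lambda>x. FD (\<lambda>(x, y). \<phi> (ginv (K x) \<odot> K y)) (x, x) (0, v))"
    by (rule smooth_on_compose[OF finite_dim_prod[OF fda fda] W(1) d smooth_on_FD[OF W(3)]]) auto
  then have "smooth_on W (\<lambda>p. lform K p v)"
    by (rule smooth_on_cong[OF W(1)]) (use lform_eq_FD2[OF W(3)] in simp)
  then show "\<exists>W. open W \<and> p \<in> W \<and> smooth_on W (\<lambda>p. lform K p v)" using W by blast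
qed

lemma smooth_at_left_translate:
  fixes K :: "'a::real_normed_vector \<Rightarrow> 'g"
  assumes "smooth_at K p"
  obtains W where "open W" "p \<in> W" "(\<lambda>q. ginv (K p) \<odot> K q) ` W \<subseteq> U0" "smooth_on W (\<lambda>q. \<phi> (ginv (K p) \<odot> K q))"
  using smooth_at_\<phi>[OF smooth_at_mul[OF smooth_at_const assms], of "ginv (K p)"] U0(2) by auto

lemma lform_has_derivative:
  assumes "smooth_at K p"
  shows "((\<lambda>q. \<phi> (ginv (K p) \<odot> K q)) has_derivative lform K p) (at p)"
proof -
  obtain W where "p \<in> W" "smooth_on W (\<lambda>q. \<phi> (ginv (K p) \<odot> K q))"
    using smooth_at_left_translate[OF assms] by metis
  from smooth_on_has_derivative[OF this(2,1)] show ?thesis unfolding lform_def by simp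
qed

lemma lform_linear: "smooth_at K p \<Longrightarrow> linear (lform K p)"
  using lform_has_derivative has_derivative_linear by blast

lemma lform_has_left_velocity:
  assumes "smooth_at K (\<gamma> t)" "(\<gamma> has_vector_derivative v) (at t within T)"
  shows "has_left_velocity G (\<lambda>t. K (\<gamma> t)) (lform K (\<gamma> t) v) t T"
proof -
  note D = lform_has_derivative[OF assms(1)]
  have "((\<lambda>s. \<phi> (ginv (K (\<gamma> t)) \<odot> K (\<gamma> s))) has_derivative (\<lambda>h. lform K (\<gamma> t) (h *\<^sub>R v))) (at t within T)"
    using has_derivative_compose[where f=\<gamma>, OF _ D] assms(2) unfolding has_vector_derivative_def by blast
  then show ?thesis
    unfolding has_left_velocity_def has_vector_derivative_def
    using linear_scale[OF has_derivative_linear[OF D]] by simp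
qed

lemma left_velocity_eq: "has_left_velocity G c \<xi> t UNIV \<Longrightarrow> left_velocity G c t UNIV = \<xi>"
  unfolding has_left_velocity_def left_velocity_def by (rule vector_derivative_at)

section \<open>Calculus rules for the Maurer--Cartan form\<close>

lemma lform_cong:
  assumes "open N" "p \<in> N" "\<And>q. q \<in> N \<Longrightarrow> K q = K' q"
  shows "lform K p v = lform K' p v"
  unfolding lform_def by (rule FD_cong_open[OF assms(1,2)]) (use assms in simp)

lemma lform_left_mul: "lform (\<lambda>q. h \<odot> K q) p v = lform K p v"
proof -
  have "ginv (h \<odot> K p) \<odot> (h \<odot> K q) = ginv (K p) \<odot> K q" for q
    by (metis grp.assoc grp.group_left_neutral grp.inverse_distrib_swap grp.left_inverse)
  then show ?thesis unfolding lform_def by simp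
qed

lemma lform_const: "lform (\<lambda>q. h) p v = 0"
  unfolding lform_def by (simp add: FD_eqI[OF has_derivative_const])

lemma lform_compose:
  assumes "smooth_at K (F p)" "(F has_derivative F') (at p)"
  shows "lform (\<lambda>q. K (F q)) p v = lform K (F p) (F' v)"
  using has_derivative_compose[OF assms(2) lform_has_derivative[OF assms(1)]]
  unfolding lform_def[of "\<lambda>q. K (F q)"] by (rule FD_eqI)

lemma lform_\<phi>i: "lform \<phi>i x0 v = v"
proof -
  have "lform \<phi>i x0 v = FD (\<lambda>x. x) x0 v"
    unfolding lform_def
    by (rule FD_cong_open[OF U0_chart(2) x0]) (simp add: \<phi>i_x0 \<phi>_\<phi>i)
  then show ?thesis by (simp add: FD_eqI[OF has_derivative_ident])
qed

lemma left_translate_eq: "h \<odot> (ginv h \<odot> k) = k"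
  by (metis grp.assoc grp.group_left_neutral grp.right_inverse)

text \<open>The left velocity of \<open>Q \<circ> c\<close> at \<open>p\<close> depends only on \<open>c(p)\<close> and the left velocity of \<open>c\<close> at \<open>p\<close>.\<close>

lemma lform_map:
  assumes c: "smooth_at c p" and Q: "smooth_at (\<lambda>y. Q (c p \<odot> \<phi>i y)) x0"
  shows "lform (\<lambda>q. Q (c q)) p v = lform (\<lambda>y. Q (c p \<odot> \<phi>i y)) x0 (lform c p v)"
proof -
  obtain W where W: "open W" "p \<in> W" "(\<lambda>q. ginv (c p) \<odot> c q) ` W \<subseteq> U0"
    using smooth_at_left_translate[OF c] by metis
  have "lform (\<lambda>q. Q (c q)) p v = lform (\<lambda>q. Q (c p \<odot> \<phi>i (\<phi> (ginv (c p) \<odot> c q)))) p v"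
    by (rule lform_cong[OF W(1,2)]) (use W(3) in \<open>auto simp: \<phi>i_\<phi> left_translate_eq\<close>)
  also have "\<dots> = lform (\<lambda>y. Q (c p \<odot> \<phi>i y)) x0 (lform c p v)"
    using lform_compose[where K="\<lambda>y. Q (c p \<odot> \<phi>i y)", OF _ lform_has_derivative[OF c]] Q by simp
  finally show ?thesis .
qed

text \<open>Near \<open>p\<close> the quotient is \<open>Q\<close> applied to the chart coordinates
  of the translates of \<open>c\<close> and \<open>d\<close> to the identity. Equal velocities make
  this a derivative of \<open>Q\<close> along the diagonal, where \<open>Q\<close> is
  constant.\<close>

lemma lform_divide_eq_0:
  assumes c: "smooth_at c p" and d: "smooth_at d p" and eq: "lform c p v = lform d p v"
  shows "lform (\<lambda>q. c q \<odot> ginv (d q)) p v = 0"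
proof -
  obtain W where W: "open W" "p \<in> W" "(\<lambda>q. ginv (c p) \<odot> c q) ` W \<subseteq> U0"
    using smooth_at_left_translate[OF c] by metis
  obtain V where V: "open V" "p \<in> V" "(\<lambda>q. ginv (d p) \<odot> d q) ` V \<subseteq> U0"
    using smooth_at_left_translate[OF d] by metis
  define Q where "Q = (\<lambda>z. c p \<odot> \<phi>i (fst z) \<odot> ginv (\<phi>i (snd z)) \<odot> ginv (d p))"
  have Q: "smooth_at Q (x0, x0)"
    unfolding Q_def
    by (intro smooth_at_mul smooth_at_inv smooth_at_const smooth_map_at_linear_compose[OF fd _ bounded_linear_fst]
          smooth_map_at_linear_compose[OF fd _ bounded_linear_snd]) (use smooth_at_\<phi>i x0 in auto)
  have Q1: "lform (\<lambda>q. Q (F q)) p v = lform Q (x0, x0) (F' v)" if "F p = (x0, x0)" "(F has_derivative F') (at p)"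
    for F F' and p v :: "'b::real_normed_vector"
    using lform_compose[where K=Q and F=F] that Q by simp
  have "lform (\<lambda>q. c q \<odot> ginv (d q)) p v =
     lform (\<lambda>q. Q (\<phi> (ginv (c p) \<odot> c q), \<phi> (ginv (d p) \<odot> d q))) p v"
  proof (rule lform_cong[of "W \<inter> V"])
    fix q assume q: "q \<in> W \<inter> V"
    then have "Q (\<phi> (ginv (c p) \<odot> c q), \<phi> (ginv (d p) \<odot> d q)) =
      c p \<odot> (ginv (c p) \<odot> c q) \<odot> ginv (ginv (d p) \<odot> d q) \<odot> ginv (d p)"
      unfolding Q_def using W(3) V(3) by (simp add: \<phi>i_\<phi> image_subset_iff)
    also have "\<dots> = c q \<odot> ginv (d q)"
      by (simp add: left_translate_eq grp.inverse_distrib_swap grp.assoc)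
    finally show "c q \<odot> ginv (d q) = Q (\<phi> (ginv (c p) \<odot> c q), \<phi> (ginv (d p) \<odot> d q))" by simp
  qed (use W V in auto)
  also have "\<dots> = lform Q (x0, x0) (lform c p v, lform d p v)"
    by (rule Q1) (auto intro!: has_derivative_Pair lform_has_derivative c d)
  also have "\<dots> = lform (\<lambda>y. Q (y, y)) x0 (lform c p v)"
    unfolding eq by (rule Q1[symmetric]) (auto intro!: derivative_eq_intros)
  also have "\<dots> = lform (\<lambda>y. c p \<odot> ginv (d p)) x0 (lform c p v)"
    by (simp add: Q_def grp.assoc left_translate_eq)
  also have "\<dots> = 0" by (rule lform_const)
  finally show ?thesis .
qed

text \<open>The coordinates of \<open>ginv (K t0) \<odot> K t\<close> have zero derivative near
  \<open>t0\<close>, so \<open>K\<close> is locally constant, and connectedness does the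
  rest.\<close>

lemma lform_zero_imp_constant:
  fixes I :: "real set"
  assumes I: "open I" "connected I" "s \<in> I" "t \<in> I"
    and K: "\<And>t. t \<in> I \<Longrightarrow> smooth_at K t" "\<And>t. t \<in> I \<Longrightarrow> lform K t 1 = 0"
  shows "K s = K t"
proof (rule connected_local_const[OF I(2-4)], intro ballI)
  fix t0 assume t0: "t0 \<in> I"
  obtain W where W: "open W" "t0 \<in> W" "(\<lambda>q. ginv (K t0) \<odot> K q) ` W \<subseteq> U0"
    using smooth_at_left_translate[OF K(1)[OF t0]] by metis
  obtain r where r: "r > 0" "ball t0 r \<subseteq> W \<inter> I"
    using W I(1) t0 open_contains_ball by (metis Int_iff open_Int)
  define x where "x = (\<lambda>t. \<phi> (ginv (K t0) \<odot> K t))"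
  have "(x has_derivative (\<lambda>h. 0)) (at t)" if t: "t \<in> ball t0 r" for t
  proof -
    \<comment> \<open>The hypothesis concerns the translate by \<open>ginv (K t)\<close>, the
      coordinate \<open>x\<close> the one by \<open>ginv (K t0)\<close>; left multiplication by
      \<open>h\<close>, written in the chart, turns the former into the latter.\<close>
    define h where "h = ginv (K t0) \<odot> K t"
    have h: "h \<in> U0" using W(3) r t unfolding h_def by blast
    note Kt = K(1)[of t] K(2)[of t]
    have tI: "t \<in> I" using r t by blast
    obtain V where V: "open V" "t \<in> V" "(\<lambda>q. ginv (K t) \<odot> K q) ` V \<subseteq> U0"
      using smooth_at_left_translate[OF K(1)[OF tI]] by metis
    have "smooth_at (\<lambda>y. h \<odot> \<phi>i y) x0" by (intro smooth_at_mul smooth_at_const smooth_at_\<phi>i x0)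
    then obtain N where N: "open N" "x0 \<in> N" "smooth_on N (\<lambda>y. \<phi> (h \<odot> \<phi>i y))"
      using h \<phi>i_x0 by (elim smooth_at_\<phi>) auto
    have "lform K t v = v *\<^sub>R lform K t 1" for v
      using linear_scale[OF lform_linear[OF K(1)[OF tI]], of v 1] by simp
    then have "((\<lambda>s. \<phi> (ginv (K t) \<odot> K s)) has_derivative (\<lambda>v. 0)) (at t)"
      using lform_has_derivative[OF K(1)[OF tI]] K(2)[OF tI] by (metis (no_types, lifting) ext scaleR_zero_right)
    then have "((\<lambda>s. \<phi> (h \<odot> \<phi>i (\<phi> (ginv (K t) \<odot> K s)))) has_derivative (\<lambda>v. FD (\<lambda>y. \<phi> (h \<odot> \<phi>i y)) x0 0)) (at t)"
      by (rule has_derivative_compose[where f="\<lambda>s. \<phi> (ginv (K t) \<odot> K s)" and g="\<lambda>y. \<phi> (h \<odot> \<phi>i y)"])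
         (use smooth_on_has_derivative[OF N(3,2)] in simp)
    then have D: "((\<lambda>s. \<phi> (h \<odot> \<phi>i (\<phi> (ginv (K t) \<odot> K s)))) has_derivative (\<lambda>v. 0)) (at t)"
      using linear_0[OF smooth_on_linear[OF N(3,2)]] by simp
    show ?thesis
      by (rule has_derivative_transform_within_open[OF D V(1,2)])
         (use V(3) in \<open>auto simp: x_def h_def \<phi>i_\<phi> grp.assoc left_translate_eq image_subset_iff\<close>)
  qed
  note dx = this
  have x: "x t = x t0" if "t \<in> ball t0 r" for t
    by (rule has_derivative_zero_unique[of "ball t0 r" x t t0, OF convex_ball has_derivative_at_withinI[OF dx]])
       (use r that in auto)
  have "ginv (K t0) \<odot> K t = ginv (K t0) \<odot> K t0" if t: "t \<in> ball t0 r" for t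
    by (rule inj_onD[OF U0_chart(4) x[OF t, unfolded x_def]]) (use W r t U0(2) in \<open>auto simp: image_subset_iff subset_iff\<close>)
  then have "K t0 = K t" if "t \<in> ball t0 r" for t using that left_translate_eq by metis
  then show "\<forall>\<^sub>F t in at t0 within I. K t0 = K t"
    unfolding eventually_at_topological using r(1) by (metis centre_in_ball open_ball)
qed

lemma lform_unique:
  fixes I :: "real set"
  assumes I: "open I" "connected I" "s \<in> I" "t \<in> I"
    and c: "\<And>t. t \<in> I \<Longrightarrow> smooth_at c t" and d: "\<And>t. t \<in> I \<Longrightarrow> smooth_at d t"
    and eq: "\<And>t. t \<in> I \<Longrightarrow> lform c t 1 = lform d t 1" and s: "c s = d s"
  shows "c t = d t"
proof -
  have "c s \<odot> ginv (d s) = c t \<odot> ginv (d t)"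
    by (rule lform_zero_imp_constant[OF I]) (use smooth_at_mul[OF c smooth_at_inv[OF d]] lform_divide_eq_0[OF c d eq] in auto)
  then have "c t \<odot> ginv (d t) = \<one>" unfolding s by simp
  then show ?thesis by (metis grp.assoc grp.left_inverse grp.right_neutral grp.group_left_neutral)
qed

section \<open>Multiplication in the unit chart and the Maurer--Cartan equation\<close>

definition mulc :: "'e \<times> 'e \<Rightarrow> 'e" where
  "mulc = (\<lambda>(x, y). \<phi> (\<phi>i x \<odot> \<phi>i y))"

text \<open>The mixed second derivative of the multiplication at the identity in the chart; its antisymmetrisation is the Lie
  bracket.\<close>

definition mixed :: "'e \<Rightarrow> 'e \<Rightarrow> 'e" where
  "mixed x y = FD (\<lambda>a. FD mulc (a, x0) (0, y)) x0 x"

lemma mulc_nhd: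
  obtains N where "open N" "x0 \<in> N" "N \<subseteq> \<phi> ` U0" "smooth_on (N \<times> N) mulc"
    "\<And>x y. x \<in> N \<Longrightarrow> y \<in> N \<Longrightarrow> \<phi>i x \<odot> \<phi>i y \<in> U0"
proof -
  have "smooth_at (\<lambda>z. \<phi>i (fst z) \<odot> \<phi>i (snd z)) (x0, x0)"
    by (intro smooth_at_mul smooth_map_at_linear_compose[OF fd _ bounded_linear_fst]
          smooth_map_at_linear_compose[OF fd _ bounded_linear_snd]) (use smooth_at_\<phi>i x0 in auto)
  then obtain V where V: "open V" "(x0, x0) \<in> V" "(\<lambda>z. \<phi>i (fst z) \<odot> \<phi>i (snd z)) ` V \<subseteq> U0"
     "smooth_on V (\<lambda>z. \<phi> (\<phi>i (fst z) \<odot> \<phi>i (snd z)))"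
    using U0(2) \<phi>i_x0 by (elim smooth_at_\<phi>) auto
  obtain A B where AB: "open A" "open B" "x0 \<in> A" "x0 \<in> B" "A \<times> B \<subseteq> V"
    using open_prod_elim[OF V(1,2)] by (metis mem_Sigma_iff)
  show thesis
  proof
    let ?N = "A \<inter> B \<inter> \<phi> ` U0"
    show "open ?N" "x0 \<in> ?N" "?N \<subseteq> \<phi> ` U0" using AB x0 U0_chart(2) by auto
    show "\<phi>i x \<odot> \<phi>i y \<in> U0" if "x \<in> ?N" "y \<in> ?N" for x y using that AB V(3) by force
    show "smooth_on (?N \<times> ?N) mulc"
      unfolding mulc_def split_def by (rule smooth_on_subset[OF V(4)]) (use AB in auto)
  qed
qed

lemma smooth_on_mulc_partial:
  assumes "open N" "x0 \<in> N" "smooth_on (N \<times> N) mulc"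
  shows "smooth_on N (\<lambda>a. FD mulc (a, x0) (0, y))"
  by (rule smooth_on_compose[OF finite_dim_prod[OF fd fd] assms(1) _ smooth_on_FD[OF assms(3)]])
     (use assms in \<open>auto intro!: smooth_on_Pair smooth_on_const smooth_on_ident\<close>)

lemma mixed_linear_left: "linear (\<lambda>x. mixed x y)"
proof -
  obtain N where N: "open N" "x0 \<in> N" "smooth_on (N \<times> N) mulc" using mulc_nhd by metis
  show ?thesis unfolding mixed_def by (rule smooth_on_linear[OF smooth_on_mulc_partial[OF N] N(2)])
qed

text \<open>For each \<open>a\<close> near \<open>x0\<close> the inner derivative is linear in its
  direction, and differentiating in \<open>a\<close> preserves the linear relations.\<close>

lemma mixed_linear_right: "linear (mixed x)"
proof -
  obtain N where N: "open N" "x0 \<in> N" "smooth_on (N \<times> N) mulc" using mulc_nhd by metis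
  have D: "((\<lambda>a. FD mulc (a, x0) (0, y)) has_derivative FD (\<lambda>a. FD mulc (a, x0) (0, y)) x0) (at x0)" for y
    by (rule smooth_on_has_derivative[OF smooth_on_mulc_partial[OF N] N(2)])
  have lin: "linear (FD mulc (a, x0))" if "a \<in> N" for a
    by (rule smooth_on_linear[OF N(3)]) (use that N in auto)
  show ?thesis
  proof (rule linearI)
    fix y z
    have "mixed x (y + z) = FD (\<lambda>a. FD mulc (a, x0) (0, y) + FD mulc (a, x0) (0, z)) x0 x"
      unfolding mixed_def
      by (rule FD_cong_open[OF N(1,2)]) (use linear_add[OF lin, of _ "(0, y)" "(0, z)"] in simp)
    then show "mixed x (y + z) = mixed x y + mixed x z"
      unfolding mixed_def using FD_eqI[OF has_derivative_add[OF D D]] by simp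
  next
    fix r y
    have "mixed x (r *\<^sub>R y) = FD (\<lambda>a. r *\<^sub>R FD mulc (a, x0) (0, y)) x0 x"
      unfolding mixed_def
      by (rule FD_cong_open[OF N(1,2)]) (use linear_scale[OF lin, of _ r "(0, y)"] in simp)
    then show "mixed x (r *\<^sub>R y) = r *\<^sub>R mixed x y"
      unfolding mixed_def using FD_eqI[OF has_derivative_scaleR_right[OF D]] by simp
  qed
qed

text \<open>Near \<open>(p, p)\<close> the map \<open>f(x, y) = K(x)\<inverse> K(y)\<close> satisfies \<open>f(x, y) = f(x, p) f(p, y)\<close> and \<open>f(x, x) = 1\<close>. Of the
  second derivatives of \<open>f\<close> only the mixed one is not symmetric in \<open>v\<close> and \<open>w\<close>, and the product formula expresses it
  through that of the multiplication.\<close>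

lemma maurer_cartan:
  fixes K :: "'a::real_inner \<Rightarrow> 'g"
  assumes fda: "finite_dim TYPE('a)" and K: "smooth_at K p"
  shows "FD (\<lambda>q. lform K q w) p v - FD (\<lambda>q. lform K q v) p w =
    mixed (lform K p w) (lform K p v) - mixed (lform K p v) (lform K p w)"
proof -
  obtain W where W: "open W" "p \<in> W" "\<And>x y. x \<in> W \<Longrightarrow> y \<in> W \<Longrightarrow> ginv (K x) \<odot> K y \<in> U0"
    and f0: "smooth_on (W \<times> W) (\<lambda>(x, y). \<phi> (ginv (K x) \<odot> K y))"
    using lform_nhd[OF fda K] by metis
  define f where "f = (\<lambda>(x, y). \<phi> (ginv (K x) \<odot> K y))"
  have f: "smooth_on (W \<times> W) f" using f0 by (simp add: f_def)
  have WW: "open (W \<times> W)" "(p, p) \<in> W \<times> W" using W by (auto intro: open_Times)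
  obtain N where N: "open N" "x0 \<in> N" "N \<subseteq> \<phi> ` U0" "smooth_on (N \<times> N) mulc"
    using mulc_nhd by metis
  have fx: "f (x, x) = x0" for x by (simp add: f_def)
  have \<theta>: "lform K x u = FD f (x, x) (0, u)" if "x \<in> W" for x u
    unfolding f_def by (rule lform_eq_FD2[OF f0 that])
  have part: "FD h (x, p) (u, 0) = FD (\<lambda>x. h (x, p)) x u"
    if "smooth_on (W \<times> W) h" "x \<in> W" for h :: "'a \<times> 'a \<Rightarrow> 'e" and x u
    by (rule FD_compose[OF that(1), symmetric]) (use W that in \<open>auto intro!: derivative_eq_intros\<close>)
  \<comment> \<open>By \<open>lform_eq_FD2\<close> the base point enters both arguments of
    \<open>f\<close>. The part in direction \<open>(0, v)\<close> is symmetric in \<open>v\<close>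
    and \<open>w\<close> by \<open>sym\<close> and cancels in the difference.\<close>
  have split: "FD (\<lambda>q. lform K q w) p v = FD (\<lambda>z. FD f z (0, w)) (p, p) (v, 0) + FD (\<lambda>z. FD f z (0, w)) (p, p) (0, v)"
    for v w
  proof -
    have "FD (\<lambda>q. lform K q w) p v = FD (\<lambda>q. FD f (q, q) (0, w)) p v"
      by (rule FD_cong_open[OF W(1,2) \<theta>])
    also have "\<dots> = FD (\<lambda>z. FD f z (0, w)) (p, p) (v, v)"
      by (rule FD_compose[OF smooth_on_FD[OF f]]) (use W in \<open>auto intro!: derivative_eq_intros\<close>)
    also have "\<dots> = FD (\<lambda>z. FD f z (0, w)) (p, p) ((v, 0) + (0, v))" by simp
    finally show ?thesis using FD_add[OF smooth_on_FD[OF f] WW(2)] by metis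
  qed
  have sym: "FD (\<lambda>z. FD f z (0, w)) (p, p) (0, v) = FD (\<lambda>z. FD f z (0, v)) (p, p) (0, w)"
    by (rule FD_commute[OF WW f])
  \<comment> \<open>Since \<open>f\<close> is constant on the diagonal, its two partial derivatives
    there are opposite; this is the source of the sign in \<open>key\<close>.\<close>
  have "FD f (p, p) (v, 0) + FD f (p, p) (0, v) = 0" for v
  proof -
    have "FD f (p, p) (v, 0) + FD f (p, p) (0, v) = FD f (p, p) (v, v)"
      using FD_add[OF f WW(2), of "(v, 0)" "(0, v)"] by simp
    also have "\<dots> = FD (\<lambda>x. f (x, x)) p v"
      by (rule FD_compose[OF f, symmetric]) (use W in \<open>auto intro!: derivative_eq_intros\<close>)
    also have "\<dots> = 0" unfolding fx by (rule FD_eqI[OF has_derivative_const])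
    finally show ?thesis .
  qed
  then have neg: "FD f (p, p) (v, 0) = - lform K p v" for v
    unfolding \<theta>[OF W(2)] by (simp add: eq_neg_iff_add_eq_0)
  have key: "FD (\<lambda>z. FD f z (0, w)) (p, p) (v, 0) = - mixed (lform K p v) (lform K p w)" for v w
  proof -
    have sm1: "smooth_on W (\<lambda>x. f (x, p))" and sm2: "smooth_on W (\<lambda>y. f (p, y))"
      by (rule smooth_on_compose[OF finite_dim_prod[OF fda fda] W(1) _ f];
          use W in \<open>auto intro!: smooth_on_Pair smooth_on_const smooth_on_ident\<close>)+
    \<comment> \<open>On \<open>A\<close> and \<open>B\<close> the two factors of the product
      formula have coordinates in \<open>N\<close>, where \<open>mulc\<close> is smooth.\<close>
    define A where "A = W \<inter> (\<lambda>x. f (x, p)) -` N"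
    define B where "B = W \<inter> (\<lambda>y. f (p, y)) -` N"
    have A: "open A" "p \<in> A" and B: "open B" "p \<in> B"
      using continuous_open_preimage[OF smooth_on_continuous[OF sm1] W(1) N(1)]
        continuous_open_preimage[OF smooth_on_continuous[OF sm2] W(1) N(1)] W(2) N(2)
      by (auto simp: A_def B_def fx)
    have "FD f (x, p) (0, w) = FD mulc (f (x, p), x0) (0, lform K p w)" if x: "x \<in> A" for x
    proof -
      have "FD f (x, p) (0, w) = FD (\<lambda>y. f (x, y)) p w"
        by (rule FD_compose[OF f, symmetric]) (use x W in \<open>auto simp: A_def intro!: derivative_eq_intros\<close>)
      also have "\<dots> = FD (\<lambda>y. mulc (f (x, p), f (p, y))) p w"
      proof (rule FD_cong_open[OF B])
        fix y assume "y \<in> B"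
        then have "ginv (K x) \<odot> K p \<in> U0" "ginv (K p) \<odot> K y \<in> U0"
          using x W by (auto simp: A_def B_def)
        moreover have "ginv (K x) \<odot> K p \<odot> (ginv (K p) \<odot> K y) = ginv (K x) \<odot> K y"
          by (simp add: grp.assoc left_translate_eq)
        ultimately show "f (x, y) = mulc (f (x, p), f (p, y))"
          by (simp add: f_def mulc_def \<phi>i_\<phi>)
      qed
      also have "\<dots> = FD mulc (f (x, p), f (p, p)) (0, lform K p w)"
      proof (rule FD_compose[OF N(4)])
        show "(f (x, p), f (p, p)) \<in> N \<times> N" using x A(2) by (auto simp: A_def)
        have "((\<lambda>y. f (p, y)) has_derivative lform K p) (at p)"
          using lform_has_derivative[OF K] by (simp add: f_def)
        then show "((\<lambda>y. (f (x, p), f (p, y))) has_derivative (\<lambda>w. (0, lform K p w))) (at p)"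
          by (intro has_derivative_Pair has_derivative_const)
      qed
      finally show ?thesis by (simp add: fx)
    qed
    note step = this
    have "FD (\<lambda>z. FD f z (0, w)) (p, p) (v, 0) = FD (\<lambda>x. FD f (x, p) (0, w)) p v"
      by (rule part[OF smooth_on_FD[OF f] W(2)])
    also have "\<dots> = FD (\<lambda>x. FD mulc (f (x, p), x0) (0, lform K p w)) p v"
      by (rule FD_cong_open[OF A step])
    also have "\<dots> = FD (\<lambda>a. FD mulc (a, x0) (0, lform K p w)) (f (p, p)) (FD (\<lambda>x. f (x, p)) p v)"
      by (rule FD_compose[OF smooth_on_mulc_partial[OF N(1,2,4)]])
         (use A(2) smooth_on_has_derivative[OF sm1 W(2)] in \<open>auto simp: A_def\<close>)
    also have "\<dots> = mixed (- lform K p v) (lform K p w)"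
      unfolding mixed_def fx part[OF f W(2), symmetric] neg ..
    finally show ?thesis using linear_neg[OF mixed_linear_left] by simp
  qed
  show ?thesis unfolding split[of w v] split[of v w] key sym by simp
qed

end

section \<open>Local solutions of autonomous differential equations\<close>

lemma has_vector_derivative_bound:
  fixes f :: "real \<Rightarrow> 'a::real_normed_vector"
  assumes "convex S" "\<And>t. t \<in> S \<Longrightarrow> (f has_vector_derivative f' t) (at t within S)"
    "\<And>t. t \<in> S \<Longrightarrow> norm (f' t) \<le> B" "x \<in> S" "y \<in> S"
  shows "norm (f x - f y) \<le> B * \<bar>x - y\<bar>"
proof -
  have "norm (f x - f y) \<le> B * norm (x - y)"
  proof (rule differentiable_bound[OF assms(1) _ _ assms(4,5)])
    show "(f has_derivative (\<lambda>h. h *\<^sub>R f' t)) (at t within S)" if "t \<in> S" for t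
      using assms(2)[OF that] unfolding has_vector_derivative_def .
    show "onorm (\<lambda>h. h *\<^sub>R f' t) \<le> B" if "t \<in> S" for t
      using assms(3)[OF that] by (intro onorm_le) (metis abs_ge_zero mult.commute mult_left_mono norm_scaleR real_norm_def)
  qed
  then show ?thesis by simp
qed

text \<open>The derivatives in the finitely many directions \<open>b\<close> are continuous, so near
  \<open>x0\<close> their norms exceed those at \<open>x0\<close> by at most 1. Weighted by the
  coordinate vectors they bound the operator norm on a convex ball.\<close>

lemma smooth_on_locally_lipschitz:
  fixes X :: "'a::real_inner \<Rightarrow> 'b::real_normed_vector"
  assumes fd: "finite_dim TYPE('a)" and N: "open N" "x0 \<in> N" and X: "smooth_on N X"
  obtains \<delta> C where "\<delta> > 0" "C \<ge> 0" "cball x0 \<delta> \<subseteq> N"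
    "\<And>y z. y \<in> cball x0 \<delta> \<Longrightarrow> z \<in> cball x0 \<delta> \<Longrightarrow> norm (X y - X z) \<le> C * norm (y - z)"
proof -
  obtain B and c where B: "finite B" "\<And>x::'a. x = (\<Sum>b\<in>B. (x \<bullet> c b) *\<^sub>R b)"
    using finite_dim_coordinates[OF fd] by metis
  have "\<forall>\<^sub>F y in nhds x0. norm (FD X y b) < norm (FD X x0 b) + 1" for b
  proof -
    have "isCont (\<lambda>y. FD X y b) x0"
      using smooth_on_continuous[OF smooth_on_FD[OF X]] N by (metis continuous_on_eq_continuous_at)
    then have "((\<lambda>y. FD X y b) \<longlongrightarrow> FD X x0 b) (nhds x0)"
      using tendsto_at_iff_tendsto_nhds[of "\<lambda>y. FD X y b" x0] by (simp add: isCont_def)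
    then have "((\<lambda>y. norm (FD X y b)) \<longlongrightarrow> norm (FD X x0 b)) (nhds x0)"
      by (rule tendsto_norm)
    then show ?thesis by (rule order_tendstoD) simp
  qed
  then have "\<forall>\<^sub>F y in nhds x0. y \<in> N \<and> (\<forall>b\<in>B. norm (FD X y b) < norm (FD X x0 b) + 1)"
    using eventually_nhds_in_open[OF N] B(1) by (intro eventually_conj eventually_ball_finite) auto
  then obtain d where d: "d > 0" "\<And>y. dist y x0 < d \<Longrightarrow> y \<in> N \<and> (\<forall>b\<in>B. norm (FD X y b) < norm (FD X x0 b) + 1)"
    unfolding eventually_nhds_metric by blast
  define C where "C = (\<Sum>b\<in>B. norm (c b) * (norm (FD X x0 b) + 1))"
  have sub: "cball x0 (d/2) \<subseteq> N" using d by (auto simp: dist_commute)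
  show thesis
  proof
    show "d/2 > 0" "cball x0 (d/2) \<subseteq> N" using d sub by auto
    show C0: "C \<ge> 0" unfolding C_def by (intro sum_nonneg) auto
    show "norm (X y - X z) \<le> C * norm (y - z)" if "y \<in> cball x0 (d/2)" "z \<in> cball x0 (d/2)" for y z
    proof (rule differentiable_bound[OF convex_cball _ _ that])
      fix x assume x: "x \<in> cball x0 (d/2)"
      then have xN: "x \<in> N" using sub by blast
      have D: "(X has_derivative FD X x) (at x)" by (rule smooth_on_has_derivative[OF X xN])
      then show "(X has_derivative FD X x) (at x within cball x0 (d/2))" by (rule has_derivative_at_withinI)
      have lin: "linear (FD X x)" using D has_derivative_linear by blast
      show "onorm (FD X x) \<le> C"
      proof (rule onorm_bound[OF C0])
        fix v
        have "FD X x (\<Sum>b\<in>B. (v \<bullet> c b) *\<^sub>R b) = (\<Sum>b\<in>B. (v \<bullet> c b) *\<^sub>R FD X x b)"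
          by (simp add: linear_sum[OF lin] linear_scale[OF lin])
        then have "norm (FD X x v) = norm (\<Sum>b\<in>B. (v \<bullet> c b) *\<^sub>R FD X x b)" unfolding B(2)[symmetric] by simp
        also have "\<dots> \<le> (\<Sum>b\<in>B. norm ((v \<bullet> c b) *\<^sub>R FD X x b))" by (rule norm_sum)
        also have "\<dots> \<le> (\<Sum>b\<in>B. (norm (c b) * (norm (FD X x0 b) + 1)) * norm v)"
        proof (rule sum_mono)
          fix b assume b: "b \<in> B"
          have "dist x x0 < d" using x d(1) by (auto simp: dist_commute)
          then have "norm (FD X x b) \<le> norm (FD X x0 b) + 1" using d(2) b by (auto intro: less_imp_le)
          then have "\<bar>v \<bullet> c b\<bar> * norm (FD X x b) \<le> (norm v * norm (c b)) * (norm (FD X x0 b) + 1)"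
            by (intro mult_mono Cauchy_Schwarz_ineq2) auto
          then show "norm ((v \<bullet> c b) *\<^sub>R FD X x b) \<le> norm (c b) * (norm (FD X x0 b) + 1) * norm v"
            by (simp add: mult_ac)
        qed
        also have "\<dots> = C * norm v" unfolding C_def by (simp add: sum_distrib_right)
        finally show "norm (FD X x v) \<le> C * norm v" .
      qed
    qed
  qed
qed

lemma local_integral_curve:
  fixes X :: "'a::{real_inner, banach} \<Rightarrow> 'a"
  assumes fd: "finite_dim TYPE('a)" and N: "open N" "x0 \<in> N" and X: "smooth_on N X"
  obtains r x where "r > 0" "x 0 = x0" "\<And>t. t \<in> {-r<..<r} \<Longrightarrow> x t \<in> N"
    "\<And>t. t \<in> {-r<..<r} \<Longrightarrow> (x has_vector_derivative X (x t)) (at t)"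
proof -
  obtain \<delta> C where \<delta>: "\<delta> > 0" "C \<ge> 0" "cball x0 \<delta> \<subseteq> N"
    and lip: "\<And>y z. y \<in> cball x0 \<delta> \<Longrightarrow> z \<in> cball x0 \<delta> \<Longrightarrow> norm (X y - X z) \<le> C * norm (y - z)"
    using smooth_on_locally_lipschitz[OF fd N X] by metis
  define M where "M = norm (X x0) + C * \<delta>"
  have M0: "M \<ge> 0" unfolding M_def using \<delta> by simp
  have M: "norm (X y) \<le> M" if "y \<in> cball x0 \<delta>" for y
  proof -
    have "norm (X y) \<le> norm (X x0) + norm (X y - X x0)" by (metis add.commute norm_triangle_sub)
    also have "norm (X y - X x0) \<le> C * norm (y - x0)" using lip that \<delta> by auto
    also have "\<dots> \<le> C * \<delta>" using that \<delta> by (intro mult_left_mono) (auto simp: dist_norm norm_minus_commute)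
    finally show ?thesis unfolding M_def by simp
  qed
  \<comment> \<open>The first bound keeps the iterates in the ball
    (\<open>M * r \<le> \<delta>\<close>), the second makes the Picard operator a contraction
    (\<open>C * r \<le> 1/2\<close>).\<close>
  define r where "r = min (\<delta> / (M + 1)) (1 / (2 * (C + 1)))"
  have r0: "r > 0" unfolding r_def using \<delta> M0 by auto
  have "M * r \<le> M * (\<delta> / (M + 1))" unfolding r_def using M0 by (intro mult_left_mono) auto
  also have "\<dots> \<le> \<delta>" using \<delta> M0 by (simp add: field_simps)
  finally have Mr: "M * r \<le> \<delta>" .
  have "C * r \<le> C * (1 / (2 * (C + 1)))" unfolding r_def using \<delta> by (intro mult_left_mono) auto
  also have "\<dots> \<le> 1/2" using \<delta> by (simp add: field_simps)
  finally have Cr: "C * r \<le> 1/2" .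
  \<comment> \<open>Bounded continuous functions on the whole line with values in the ball form a
    closed, hence complete, set.\<close>
  define S where "S = (PiC UNIV (\<lambda>_. cball x0 \<delta>) :: (real \<Rightarrow>\<^sub>C 'a) set)"
  have SD: "apply_bcontfun f t \<in> cball x0 \<delta>" if "f \<in> S" for f t
    using that unfolding S_def by (auto simp: mem_PiC_iff)
  have "complete S" unfolding S_def complete_eq_closed by (intro closed_PiC closed_cball)
  have const: "const_bcontfun x0 \<in> S" unfolding S_def using \<delta> by (auto simp: mem_PiC_iff)
  \<comment> \<open>The integral starts at \<open>-r\<close>, which avoids oriented integrals for
    negative times; subtracting \<open>F f 0\<close> later moves the initial time to 0.\<close>
  define F where "F = (\<lambda>(f::real \<Rightarrow>\<^sub>C 'a) t. integral {-r..t} (\<lambda>s. X (apply_bcontfun f s)))"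
  have contX: "continuous_on T (\<lambda>s. X (apply_bcontfun f s))" if "f \<in> S" for f T
    by (rule continuous_on_compose2[OF smooth_on_continuous[OF X]]) (use SD[OF that] \<delta>(3) in \<open>auto\<close>)
  have DF: "(F f has_vector_derivative X (apply_bcontfun f t)) (at t within {-r..r})" if "f \<in> S" "t \<in> {-r..r}" for f t
    unfolding F_def by (rule integral_has_vector_derivative[OF contX[OF that(1)] that(2)])
  have rr: "0 \<in> {-r..r}" using r0 by simp
  have Fb: "norm (F f t - F f 0) \<le> \<delta>" if "f \<in> S" "t \<in> {-r..r}" for f t
  proof -
    have "norm (F f t - F f 0) \<le> M * \<bar>t - 0\<bar>"
      by (rule has_vector_derivative_bound[OF convex_real_interval(5) DF[OF that(1)] _ that(2) rr])
         (use M SD that in auto)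
    also have "\<dots> \<le> M * r" using that M0 by (intro mult_left_mono) auto
    finally show ?thesis using Mr by simp
  qed
  have Fd: "norm ((F f t - F f 0) - (F g t - F g 0)) \<le> 1/2 * dist f g" if "f \<in> S" "g \<in> S" "t \<in> {-r..r}" for f g t
  proof -
    have "norm ((F f t - F g t) - (F f 0 - F g 0)) \<le> (C * dist f g) * \<bar>t - 0\<bar>"
    proof (rule has_vector_derivative_bound[OF convex_real_interval(5) has_vector_derivative_diff[OF DF[OF that(1)] DF[OF that(2)]] _ that(3) rr])
      fix s
      have "norm (X (apply_bcontfun f s) - X (apply_bcontfun g s)) \<le> C * norm (apply_bcontfun f s - apply_bcontfun g s)"
        by (rule lip[OF SD[OF that(1)] SD[OF that(2)]])
      also have "\<dots> \<le> C * dist f g" using \<delta> dist_bounded[of f s g] by (intro mult_left_mono) (auto simp: dist_norm)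
      finally show "norm (X (apply_bcontfun f s) - X (apply_bcontfun g s)) \<le> C * dist f g" .
    qed
    also have "\<dots> \<le> (C * dist f g) * r" using that \<delta> by (intro mult_left_mono) auto
    also have "\<dots> = (C * r) * dist f g" by simp
    also have "\<dots> \<le> 1/2 * dist f g" using Cr by (intro mult_right_mono) auto
    finally show ?thesis by (simp add: algebra_simps)
  qed
  \<comment> \<open>Clamping time to \<open>{-r..r}\<close> extends the iterates to the whole line,
    as membership in \<open>S\<close> demands.\<close>
  define cl where "cl = (\<lambda>t. max (-r) (min r t))"
  have cl: "cl t \<in> {-r..r}" for t unfolding cl_def using r0 by auto
  have cl_id: "cl t = t" if "t \<in> {-r..r}" for t using that unfolding cl_def by auto
  have ccl: "continuous_on UNIV cl" unfolding cl_def by (intro continuous_intros)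
  define T where "T = (\<lambda>f. Bcontfun (\<lambda>t. x0 + (F f (cl t) - F f 0)))"
  have T: "apply_bcontfun (T f) t = x0 + (F f (cl t) - F f 0)" if "f \<in> S" for f t
  proof -
    have "continuous_on {-r..r} (F f)"
      using DF[OF that] has_vector_derivative_continuous unfolding continuous_on_eq_continuous_within by blast
    then have "continuous_on UNIV (\<lambda>t. F f (cl t))"
      by (rule continuous_on_compose2[OF _ ccl]) (use cl in auto)
    then have "continuous_on UNIV (\<lambda>t. x0 + (F f (cl t) - F f 0))" by (intro continuous_intros)
    moreover have "norm (x0 + (F f (cl t) - F f 0)) \<le> norm x0 + \<delta>" for t
      using norm_triangle_mono[OF order_refl Fb[OF that cl]] .
    ultimately have "(\<lambda>t. x0 + (F f (cl t) - F f 0)) \<in> bcontfun" by (rule bcontfun_normI)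
    then show ?thesis unfolding T_def by (simp add: Bcontfun_inverse)
  qed
  have "\<exists>!f\<in>S. T f = f"
  proof (rule Banach_fix[OF \<open>complete S\<close> _ _ _ _ ])
    show "S \<noteq> {}" using const by blast
    show "T ` S \<subseteq> S"
    proof safe
      fix f assume f: "f \<in> S"
      have "apply_bcontfun (T f) t \<in> cball x0 \<delta>" for t
        using Fb[OF f cl[of t]] by (simp add: T[OF f] dist_norm norm_minus_commute)
      then show "T f \<in> S" unfolding S_def by (simp add: mem_PiC_iff)
    qed
    show "dist (T f) (T g) \<le> 1/2 * dist f g" if "f \<in> S" "g \<in> S" for f g
    proof (rule dist_bound)
      fix t
      have "apply_bcontfun (T f) t - apply_bcontfun (T g) t = (F f (cl t) - F f 0) - (F g (cl t) - F g 0)"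
        using T that by simp
      then show "dist (apply_bcontfun (T f) t) (apply_bcontfun (T g) t) \<le> 1/2 * dist f g"
        using Fd[OF that cl, of t] by (simp only: dist_norm)
    qed
  qed auto
  then obtain f where f: "f \<in> S" "T f = f" by blast
  define x where "x = apply_bcontfun f"
  have x: "x t = x0 + (F f t - F f 0)" if "t \<in> {-r..r}" for t
    using T[OF f(1), of t] cl_id[OF that] f(2) by (simp add: x_def)
  show thesis
  proof
    show "r > 0" by fact
    show "x 0 = x0" using x[OF rr] by simp
    fix t assume t: "t \<in> {-r<..<r}"
    show "x t \<in> N" using SD[OF f(1)] \<delta>(3) unfolding x_def by blast
    have t': "t \<in> {-r..r}" using t by auto
    have "((\<lambda>t. x0 + (F f t - F f 0)) has_vector_derivative 0 + (X (x t) - 0)) (at t within {-r..r})"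
      using DF[OF f(1) t'] unfolding x_def by (intro has_vector_derivative_add has_vector_derivative_diff has_vector_derivative_const)
    then have "(x has_vector_derivative X (x t)) (at t within {-r..r})"
      using has_vector_derivative_transform[OF t' x] by simp
    then show "(x has_vector_derivative X (x t)) (at t)"
      using at_within_Icc_at[of "-r" t r] t by auto
  qed
qed

text \<open>Bootstrapping: if \<open>x\<close> is differentiable \<open>n\<close> times, so is
  \<open>X (x t)\<close>, which is the derivative of \<open>x\<close>.\<close>

lemma smooth_on_integral_curve:
  fixes X :: "'a::real_inner \<Rightarrow> 'a"
  assumes fd: "finite_dim TYPE('a)" and I: "open I" and X: "smooth_on N X"
    and x: "\<And>t. t \<in> I \<Longrightarrow> x t \<in> N" "\<And>t. t \<in> I \<Longrightarrow> (x has_vector_derivative X (x t)) (at t)"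
  shows "smooth_on I x"
proof -
  have "times_differentiable_on n I x" for n
  proof (induction n)
    case 0
    then show ?case
      using x(2) by (auto intro!: continuous_at_imp_continuous_on has_vector_derivative_continuous)
  next
    case (Suc n)
    show ?case
    proof (rule times_differentiable_on_SucI[OF I, where f'="\<lambda>t v. v *\<^sub>R X (x t)"])
      show "(x has_derivative (\<lambda>v. v *\<^sub>R X (x t))) (at t)" if "t \<in> I" for t
        using x(2)[OF that] unfolding has_vector_derivative_def .
      show "times_differentiable_on n I (\<lambda>t. v *\<^sub>R X (x t))" for v
      proof (rule times_differentiable_on_linear_compose[OF bounded_linear_scaleR_right I])
        show "times_differentiable_on n I (\<lambda>t. X (x t))"
          by (rule times_differentiable_on_compose[OF fd I Suc.IH]) (use X x(1) in \<open>auto simp: smooth_on_def\<close>)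
      qed
    qed
  qed
  then show ?thesis unfolding smooth_on_def by blast
qed

section \<open>The exponential map\<close>

lemma smooth_map_at_affine:
  fixes c :: "real \<Rightarrow> 'q::topological_space"
  assumes "smooth_map_at A c (s + r * t)"
  shows "smooth_map_at A (\<lambda>t. c (s + r * t)) t"
  by (rule smooth_map_at_compose[OF finite_dim_euclidean, of A c "\<lambda>t. s + r * t" t UNIV])
     (use assms in \<open>auto intro!: smooth_on_add smooth_on_const smooth_on_bounded_linear[OF bounded_linear_mult_right]\<close>)

context Lie
begin

text \<open>Local one-parameter subgroups, described as integral curves of a left-invariant vector
  field instead of as homomorphisms; this form can be restricted, compared and extended on
  intervals.\<close>

definition exp_on :: "'e \<Rightarrow> real \<Rightarrow> (real \<Rightarrow> 'g) \<Rightarrow> bool" where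
  "exp_on \<zeta> r c \<longleftrightarrow> c 0 = \<one> \<and> (\<forall>t\<in>{-r<..<r}. smooth_at c t \<and> lform c t 1 = \<zeta>)"

lemma exp_onD: "exp_on \<zeta> r c \<Longrightarrow> \<bar>t\<bar> < r \<Longrightarrow> smooth_at c t \<and> lform c t 1 = \<zeta>"
  unfolding exp_on_def by (simp add: abs_less_iff)

lemma exp_on_local: "\<exists>r>0. \<exists>c. exp_on \<zeta> r c"
proof -
  obtain N where N: "open N" "x0 \<in> N" "N \<subseteq> \<phi> ` U0" "smooth_on (N \<times> N) mulc"
    "\<And>x y. x \<in> N \<Longrightarrow> y \<in> N \<Longrightarrow> \<phi>i x \<odot> \<phi>i y \<in> U0"
    using mulc_nhd by metis
  \<comment> \<open>The left-invariant vector field of \<open>\<zeta>\<close> in the unit chart: the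
    derivative of right multiplication by a point leaving the identity in direction
    \<open>\<zeta>\<close>.\<close>
  define X where "X = (\<lambda>y. FD mulc (y, x0) (0, \<zeta>))"
  have X: "smooth_on N X" unfolding X_def by (rule smooth_on_mulc_partial[OF N(1,2,4)])
  obtain r x where r: "r > 0" "x 0 = x0" "\<And>t. t \<in> {-r<..<r} \<Longrightarrow> x t \<in> N"
    "\<And>t. t \<in> {-r<..<r} \<Longrightarrow> (x has_vector_derivative X (x t)) (at t)"
    using local_integral_curve[OF fd N(1,2) X] by metis
  have sx: "smooth_on {-r<..<r} x"
    by (rule smooth_on_integral_curve[OF fd _ X]) (use r in auto)
  have "smooth_at (\<lambda>t. \<phi>i (x t)) t \<and> lform (\<lambda>t. \<phi>i (x t)) t 1 = \<zeta>" if t: "t \<in> {-r<..<r}" for t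
  proof
    have xt: "x t \<in> N" using r(3) t .
    then have xt': "x t \<in> \<phi> ` U0" using N(3) by blast
    show "smooth_at (\<lambda>t. \<phi>i (x t)) t"
      by (rule smooth_map_at_compose[OF fd smooth_at_\<phi>i[OF xt'] _ t sx]) simp
    \<comment> \<open>Left translation preserves the form. Passing through \<open>mulc\<close> gives
      its value \<open>\<zeta>\<close> on \<open>X\<close> at \<open>x t\<close>, and the chain rule
      along \<open>x\<close> carries this to the curve.\<close>
    have "\<zeta> = lform (\<lambda>z. \<phi>i (x t) \<odot> \<phi>i z) x0 \<zeta>" by (simp add: lform_left_mul lform_\<phi>i)
    also have "\<dots> = lform (\<lambda>z. \<phi>i (mulc (x t, z))) x0 \<zeta>"
      by (rule lform_cong[OF N(1,2)]) (use N(5) xt in \<open>auto simp: mulc_def \<phi>i_\<phi>\<close>)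
    also have "\<dots> = lform \<phi>i (mulc (x t, x0)) (X (x t))"
      unfolding X_def
    proof (rule lform_compose)
      have "\<phi> (\<phi>i (x t)) = x t" using \<phi>_\<phi>i[OF xt'] .
      then have "mulc (x t, x0) = x t" by (simp add: mulc_def \<phi>i_x0)
      then show "smooth_at \<phi>i (mulc (x t, x0))" using smooth_at_\<phi>i[OF xt'] by simp
      have P: "(Pair (x t) has_derivative (\<lambda>v. (0, v))) (at x0)" by (auto intro!: derivative_eq_intros)
      show "((\<lambda>z. mulc (x t, z)) has_derivative (\<lambda>v. FD mulc (x t, x0) (0, v))) (at x0)"
        by (rule has_derivative_compose[OF P smooth_on_has_derivative[OF N(4)]]) (use xt N(2) in auto)
    qed
    also have "\<dots> = lform \<phi>i (x t) (1 *\<^sub>R X (x t))"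
      using \<phi>_\<phi>i[OF xt'] by (simp add: mulc_def \<phi>i_x0)
    also have "\<dots> = lform (\<lambda>t. \<phi>i (x t)) t 1"
      using r(4)[OF t] unfolding has_vector_derivative_def
      by (intro lform_compose[symmetric, where F=x] smooth_at_\<phi>i[OF xt'])
    finally show "lform (\<lambda>t. \<phi>i (x t)) t 1 = \<zeta>" by simp
  qed
  then have "exp_on \<zeta> r (\<lambda>t. \<phi>i (x t))" unfolding exp_on_def using r(2) \<phi>i_x0 by simp
  then show ?thesis using r(1) by blast
qed

section \<open>From local to global one-parameter subgroups\<close>

lemma lform_affine:
  fixes c :: "real \<Rightarrow> 'g"
  assumes "smooth_at c (s + r * t)"
  shows "lform (\<lambda>t. c (s + r * t)) t 1 = r *\<^sub>R lform c (s + r * t) 1"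
proof -
  have "lform (\<lambda>t. c (s + r * t)) t 1 = lform c (s + r * t) (r * 1)"
    by (rule lform_compose[where F="\<lambda>t. s + r * t"]) (use assms in \<open>auto intro!: derivative_eq_intros\<close>)
  then show ?thesis using linear_scale[OF lform_linear[OF assms], of r 1] by simp
qed

lemma exp_on_unique:
  assumes "exp_on \<zeta> r c" "exp_on \<zeta> r d" "\<bar>t\<bar> < r"
  shows "c t = d t"
  by (rule lform_unique[of "{-r<..<r}" 0]) (use assms in \<open>auto simp: exp_on_def\<close>)

lemma exp_on_mono: "exp_on \<zeta> r c \<Longrightarrow> r' \<le> r \<Longrightarrow> exp_on \<zeta> r' c"
  unfolding exp_on_def by auto

text \<open>As functions of the second summand, both sides have left velocity \<open>\<zeta>\<close>
  and agree at 0. The interval is shortened by \<open>\<bar>s\<bar>\<close> so that the sum stays in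
  the domain.\<close>

lemma exp_on_add:
  assumes c: "exp_on \<zeta> r c" and st: "\<bar>s\<bar> + \<bar>t\<bar> < r"
  shows "c (s + t) = c s \<odot> c t"
proof -
  let ?I = "{-(r - \<bar>s\<bar>)<..<r - \<bar>s\<bar>}"
  have 1: "smooth_at c \<tau>" "lform c \<tau> 1 = \<zeta>" if "\<bar>\<tau>\<bar> < r" for \<tau>
    using exp_onD[OF c that] by auto
  have in_r: "\<bar>\<tau>\<bar> < r" "\<bar>s + \<tau>\<bar> < r" if "\<tau> \<in> ?I" for \<tau> using that by auto
  show ?thesis
  proof (rule lform_unique[of ?I 0 t "\<lambda>\<tau>. c (s + \<tau>)" "\<lambda>\<tau>. c s \<odot> c \<tau>"])
    show "smooth_at (\<lambda>\<tau>. c (s + \<tau>)) \<tau>" if "\<tau> \<in> ?I" for \<tau>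
      using smooth_map_at_affine[of "charts G" c s 1 \<tau>] 1 in_r[OF that] by simp
    show "smooth_at (\<lambda>\<tau>. c s \<odot> c \<tau>) \<tau>" if "\<tau> \<in> ?I" for \<tau>
      using 1 in_r[OF that] by (intro smooth_at_mul smooth_at_const)
    show "lform (\<lambda>\<tau>. c (s + \<tau>)) \<tau> 1 = lform (\<lambda>\<tau>. c s \<odot> c \<tau>) \<tau> 1" if "\<tau> \<in> ?I" for \<tau>
      using lform_affine[of c s 1 \<tau>] 1 in_r[OF that] by (simp add: lform_left_mul)
    show "c (s + 0) = c s \<odot> c 0" using c by (simp add: exp_on_def)
  qed (use st in auto)
qed

text \<open>The sum \<open>s + t\<close> may leave the interval, but half of it does not. Hence
  \<open>c (s/2)\<close> and \<open>c (t/2)\<close> commute, and so do their squares.\<close>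

lemma exp_on_commute:
  assumes c: "exp_on \<zeta> r c" and s: "\<bar>s\<bar> < r" and t: "\<bar>t\<bar> < r"
  shows "c s \<odot> c t = c t \<odot> c s"
proof -
  define a where "a = c (s/2)"
  define b where "b = c (t/2)"
  have "c (s/2 + t/2) = a \<odot> b" "c (t/2 + s/2) = b \<odot> a"
    unfolding a_def b_def by (rule exp_on_add[OF c]; use s t in simp)+
  then have ab: "a \<odot> b = b \<odot> a" by (simp add: add.commute)
  have "c (s/2 + s/2) = a \<odot> a" "c (t/2 + t/2) = b \<odot> b"
    unfolding a_def b_def by (rule exp_on_add[OF c]; use s t in simp)+
  then have "c s = a \<odot> a" "c t = b \<odot> b" by simp_all
  then show ?thesis using ab by (metis grp.assoc)
qed

text \<open>Both partial velocities of \<open>c \<sigma> \<odot> c \<tau>\<close> at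
  \<open>(s, s)\<close> equal \<open>\<zeta>\<close>: the second by left invariance, the first
  because the factors commute. Each contributes with weight 1/2.\<close>

lemma exp_on_double:
  assumes c: "exp_on \<zeta> r c"
  shows "exp_on \<zeta> (2 * r) (\<lambda>t. c (t/2) \<odot> c (t/2))"
  unfolding exp_on_def
proof (intro conjI ballI)
  show "c (0/2) \<odot> c (0/2) = \<one>" using c by (simp add: exp_on_def)
  fix t assume t: "t \<in> {- (2 * r)<..<2 * r}"
  define s where "s = t/2"
  have s: "\<bar>s\<bar> < r" using t unfolding s_def by auto
  have 1: "smooth_at c \<tau>" "lform c \<tau> 1 = \<zeta>" if "\<bar>\<tau>\<bar> < r" for \<tau>
    using exp_onD[OF c that] by auto
  have "smooth_at (\<lambda>t. c (t/2)) t"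
    using smooth_map_at_affine[of "charts G" c 0 "1/2" t] 1 s by (simp add: s_def)
  then show "smooth_at (\<lambda>t. c (t/2) \<odot> c (t/2)) t" by (intro smooth_at_mul)
  define K where "K = (\<lambda>z. c (fst z) \<odot> c (snd z))"
  have K: "smooth_at K (s, s)"
    unfolding K_def using 1(1)[OF s]
    by (intro smooth_at_mul smooth_map_at_linear_compose[OF finite_dim_euclidean _ bounded_linear_fst]
         smooth_map_at_linear_compose[OF finite_dim_euclidean _ bounded_linear_snd]) auto
  have c1: "lform (\<lambda>t. K (F t)) \<tau> 1 = lform K (s, s) (F' 1)"
    if "F \<tau> = (s, s)" "(F has_derivative F') (at \<tau>)" for F F' and \<tau> :: real
    using lform_compose[of K F \<tau> F' 1] that K by simp
  have "lform K (s, s) (0, 1) = lform (\<lambda>\<tau>. K (s, \<tau>)) s 1"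
    by (rule c1[symmetric]) (auto intro!: derivative_eq_intros)
  also have "\<dots> = \<zeta>" using 1[OF s] by (simp add: K_def lform_left_mul)
  finally have K1: "lform K (s, s) (0, 1) = \<zeta>" .
  have "lform K (s, s) (1, 0) = lform (\<lambda>\<tau>. K (\<tau>, s)) s 1"
    by (rule c1[symmetric]) (auto intro!: derivative_eq_intros)
  also have "\<dots> = lform (\<lambda>\<tau>. K (s, \<tau>)) s 1"
    by (rule lform_cong[of "{-r<..<r}"]) (use s exp_on_commute[OF c _ s] in \<open>auto simp: K_def\<close>)
  also have "\<dots> = \<zeta>" using 1[OF s] by (simp add: K_def lform_left_mul)
  finally have K2: "lform K (s, s) (1, 0) = \<zeta>" .
  have "lform (\<lambda>t. K (t/2, t/2)) t 1 = lform K (s, s) (1/2, 1/2)"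
    by (rule c1) (auto simp: s_def intro!: derivative_eq_intros)
  also have "\<dots> = lform K (s, s) ((1/2) *\<^sub>R (1, 0) + (1/2) *\<^sub>R (0, 1))" by simp
  also have "\<dots> = (1/2) *\<^sub>R \<zeta> + (1/2) *\<^sub>R \<zeta>"
    using K1 K2 by (simp only: linear_add[OF lform_linear[OF K]] linear_scale[OF lform_linear[OF K]])
  also have "\<dots> = \<zeta>" by (simp flip: scaleR_add_left)
  finally show "lform (\<lambda>t. c (t/2) \<odot> c (t/2)) t 1 = \<zeta>" by (simp add: K_def)
qed

lemma exp_on_all: "\<exists>c. exp_on \<zeta> r c"
proof -
  obtain r0 c0 where r0: "r0 > 0" "exp_on \<zeta> r0 c0" using exp_on_local by blast
  have "\<exists>c. exp_on \<zeta> (2 ^ n * r0) c" for n :: nat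
  proof (induction n)
    case 0
    then show ?case using r0 by auto
  next
    case (Suc n)
    then obtain c where "exp_on \<zeta> (2 ^ n * r0) c" by blast
    from exp_on_double[OF this] show ?case by (auto simp: mult.assoc)
  qed
  moreover obtain n :: nat where "r / r0 < 2 ^ n" using real_arch_pow[of 2] by auto
  then have "r \<le> 2 ^ n * r0" using r0 by (simp add: field_simps)
  ultimately show ?thesis using exp_on_mono by blast
qed

text \<open>Uniqueness glues the curves: the value at \<open>t\<close> is taken from the one on
  radius \<open>\<bar>t\<bar> + 1\<close>, and any other radius beyond \<open>\<bar>t\<bar>\<close>
  gives the same value.\<close>

lemma exp_on_global: "\<exists>c. \<forall>r. exp_on \<zeta> r c"
proof -
  obtain C where C: "\<And>r. exp_on \<zeta> r (C r)" using exp_on_all by metis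
  define c where "c = (\<lambda>t. C (\<bar>t\<bar> + 1) t)"
  have eq: "C r t = c t" if "\<bar>t\<bar> < r" for r t
  proof -
    let ?s = "min r (\<bar>t\<bar> + 1)"
    have "exp_on \<zeta> ?s (C r)" "exp_on \<zeta> ?s (C (\<bar>t\<bar> + 1))" using C exp_on_mono by (meson min.cobounded1 min.cobounded2)+
    then show ?thesis unfolding c_def using that by (elim exp_on_unique) auto
  qed
  have "exp_on \<zeta> r c" for r
    unfolding exp_on_def
  proof (intro conjI ballI)
    show "c 0 = \<one>" using C[of 1] by (simp add: c_def exp_on_def)
    fix t assume t: "t \<in> {-r<..<r}"
    have t': "smooth_at (C r) t" "lform (C r) t 1 = \<zeta>" using C[of r] t unfolding exp_on_def by auto
    show "smooth_at c t"
      by (rule smooth_map_at_cong[OF t'(1), of "{-r<..<r}"]) (use t eq in auto)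
    have "lform c t 1 = lform (C r) t 1"
      by (rule lform_cong[of "{-r<..<r}"]) (use t eq in auto)
    then show "lform c t 1 = \<zeta>" using t'(2) by simp
  qed
  then show ?thesis by blast
qed

text \<open>For a homomorphism, left translation by \<open>c t\<close> carries the velocity at 0 to
  the velocity at \<open>t\<close>; conversely, \<open>exp_on_add\<close> yields the homomorphism
  property.\<close>

lemma one_parameter_subgroup_iff: "one_parameter_subgroup G \<zeta> c \<longleftrightarrow> (\<forall>r. exp_on \<zeta> r c)"
proof
  assume "\<forall>r. exp_on \<zeta> r c"
  then have c: "exp_on \<zeta> r c" for r by blast
  have s: "smooth_at c t" "lform c t 1 = \<zeta>" for t
    using exp_onD[OF c[of "\<bar>t\<bar> + 1"], of t] by auto
  have "has_left_velocity G c (lform c 0 1) 0 UNIV"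
    by (rule lform_has_left_velocity[where \<gamma>="\<lambda>t. t"]) (auto intro: s has_vector_derivative_id)
  then show "one_parameter_subgroup G \<zeta> c"
    unfolding one_parameter_subgroup_def
    using s exp_on_add[OF c less_add_one] by (auto simp: smooth_map_on_vec_iff)
next
  assume c: "one_parameter_subgroup G \<zeta> c"
  then have s: "smooth_at c t" for t unfolding one_parameter_subgroup_def by (simp add: smooth_map_on_vec_iff)
  have add: "c (s + t) = c s \<odot> c t" for s t using c unfolding one_parameter_subgroup_def by blast
  have "c 0 = c 0 \<odot> c 0" using add[of 0 0] by simp
  then have c0: "c 0 = \<one>" by (metis grp.left_cancel grp.right_neutral)
  have "has_left_velocity G c (lform c 0 1) 0 UNIV"
    by (rule lform_has_left_velocity[where \<gamma>="\<lambda>t. t"]) (auto intro: s has_vector_derivative_id)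
  then have v: "lform c 0 1 = \<zeta>"
    using c unfolding one_parameter_subgroup_def has_left_velocity_def by (blast intro: vector_derivative_unique_at)
  have "lform c t 1 = \<zeta>" for t
  proof -
    have "lform c t 1 = lform (\<lambda>\<tau>. c (t + 1 * \<tau>)) 0 1" using lform_affine[of c t 1 0] s by simp
    also have "\<dots> = \<zeta>" using v by (simp add: add lform_left_mul)
    finally show ?thesis .
  qed
  then show "\<forall>r. exp_on \<zeta> r c" unfolding exp_on_def using c0 s by blast
qed

lemma one_parameter_subgroup_ex1: "\<exists>!c. one_parameter_subgroup G \<zeta> c"
proof -
  obtain c where c: "\<forall>r. exp_on \<zeta> r c" using exp_on_global by blast
  have "d = c" if "\<forall>r. exp_on \<zeta> r d" for d
  proof
    fix t show "d t = c t" using exp_on_unique[of \<zeta> "\<bar>t\<bar> + 1" d c t] that c by simp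
  qed
  then show ?thesis unfolding one_parameter_subgroup_iff using c by blast
qed

text \<open>\<open>lie_exp\<close> evaluates at time 1 a subgroup that depends on its argument. The
  one belonging to \<open>s *\<^sub>R \<zeta>\<close> is that of \<open>\<zeta>\<close> run at speed
  \<open>s\<close>, so its value at 1 is \<open>c s\<close>.\<close>

lemma exp_curve: "exp_on \<zeta> r (\<lambda>s. lie_exp G (s *\<^sub>R \<zeta>))"
proof -
  obtain c where c: "\<And>r. exp_on \<zeta> r c" using exp_on_global by blast
  have "lie_exp G (s *\<^sub>R \<zeta>) = c s" for s
  proof -
    have s: "smooth_at c t" "lform c t 1 = \<zeta>" for t
      using exp_onD[OF c[of "\<bar>t\<bar> + 1"], of t] by auto
    have "exp_on (s *\<^sub>R \<zeta>) r (\<lambda>t. c (0 + s * t))" for r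
      unfolding exp_on_def
    proof (intro conjI ballI)
      show "c (0 + s * 0) = \<one>" using c by (simp add: exp_on_def)
      show "smooth_at (\<lambda>t. c (0 + s * t)) t" for t by (rule smooth_map_at_affine[OF s(1)])
      show "lform (\<lambda>t. c (0 + s * t)) t 1 = s *\<^sub>R \<zeta>" for t using lform_affine[OF s(1)] s(2) by metis
    qed
    then have "one_parameter_subgroup G (s *\<^sub>R \<zeta>) (\<lambda>t. c (0 + s * t))"
      unfolding one_parameter_subgroup_iff by blast
    then have "(THE c. one_parameter_subgroup G (s *\<^sub>R \<zeta>) c) = (\<lambda>t. c (0 + s * t))"
      using one_parameter_subgroup_ex1 by (rule the1_equality[rotated])
    then show ?thesis unfolding lie_exp_def by simp
  qed
  then show ?thesis using c by simp
qed

lemma lie_exp_0: "lie_exp G 0 = \<one>"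
  using exp_curve[of 0 1] by (simp add: exp_on_def)

lemma smooth_at_exp: "smooth_at (\<lambda>s. lie_exp G (s *\<^sub>R \<zeta>)) t" and lform_exp: "lform (\<lambda>s. lie_exp G (s *\<^sub>R \<zeta>)) t 1 = \<zeta>"
  using exp_onD[OF exp_curve[of \<zeta> "\<bar>t\<bar> + 1"], of t] by auto

lemma lie_exp_add: "lie_exp G ((s + t) *\<^sub>R \<zeta>) = lie_exp G (s *\<^sub>R \<zeta>) \<odot> lie_exp G (t *\<^sub>R \<zeta>)"
  by (rule exp_on_add[OF exp_curve[of \<zeta> "\<bar>s\<bar> + \<bar>t\<bar> + 1"]]) simp

end

section \<open>The adjoint representation and the Maurer--Cartan equation\<close>

context Lie
begin

lemma left_velocity_lform:
  assumes "smooth_at K (\<gamma> t)" "(\<gamma> has_vector_derivative v) (at t)"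
  shows "left_velocity G (\<lambda>t. K (\<gamma> t)) t UNIV = lform K (\<gamma> t) v"
  by (rule left_velocity_eq[OF lform_has_left_velocity[OF assms]])

lemma left_velocity_lform1: "smooth_at c t \<Longrightarrow> left_velocity G c t UNIV = lform c t 1"
  using left_velocity_lform[where \<gamma>="\<lambda>t. t"] has_vector_derivative_id by blast

lemma lform_path:
  assumes "smooth_at K (\<gamma> t)" "(\<gamma> has_vector_derivative v) (at t)"
  shows "lform (\<lambda>t. K (\<gamma> t)) t 1 = lform K (\<gamma> t) v"
  using lform_compose[of K \<gamma> t "\<lambda>h. h *\<^sub>R v" 1] assms unfolding has_vector_derivative_def by simp

lemma lie_exp_minus: "lie_exp G ((- t) *\<^sub>R \<zeta>) = ginv (lie_exp G (t *\<^sub>R \<zeta>))"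
proof -
  have "lie_exp G ((- t) *\<^sub>R \<zeta>) \<odot> lie_exp G (t *\<^sub>R \<zeta>) = \<one>"
    using lie_exp_add[of "-t" t \<zeta>] lie_exp_0 by simp
  then show ?thesis by (metis grp.assoc grp.right_inverse grp.right_neutral grp.group_left_neutral)
qed

text \<open>The Maurer--Cartan equation of the surface \<open>exp(s\<eta>) exp(-t\<xi>)\<close>.\<close>

lemma ad_eq_mixed: "ad G \<xi> \<eta> = mixed \<xi> \<eta> - mixed \<eta> \<xi>"
proof -
  \<comment> \<open>With the factors in this order, the left velocity in \<open>t\<close> is the
    constant \<open>-\<xi>\<close>, while the one in \<open>s\<close> at \<open>s = 0\<close> is the
    adjoint action of \<open>exp(t\<xi>)\<close> on \<open>\<eta>\<close>.\<close>
  define K where "K = (\<lambda>z. lie_exp G (fst z *\<^sub>R \<eta>) \<odot> lie_exp G ((- snd z) *\<^sub>R \<xi>))"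
  have fd2: "finite_dim TYPE(real \<times> real)" by (rule finite_dim_euclidean)
  have K: "smooth_at K z" for z
    unfolding K_def
    by (intro smooth_at_mul smooth_map_at_linear_compose[OF finite_dim_euclidean smooth_at_exp]
          bounded_linear_fst bounded_linear_minus bounded_linear_snd)
  have \<theta>t: "lform K (s, t) (0, 1) = - \<xi>" for s t
  proof -
    have "lform K (s, t) (0, 1) = lform (\<lambda>\<tau>. K (s, \<tau>)) t 1"
      by (rule lform_path[symmetric]) (auto intro!: K derivative_eq_intros simp: has_vector_derivative_def)
    also have "\<dots> = lform (\<lambda>\<tau>. lie_exp G ((0 + (-1) * \<tau>) *\<^sub>R \<xi>)) t 1"
      by (simp add: K_def lform_left_mul)
    also have "\<dots> = - \<xi>"
      using lform_affine[where c="\<lambda>s. lie_exp G (s *\<^sub>R \<xi>)", OF smooth_at_exp, of 0 "-1"] lform_exp by simp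
    finally show ?thesis .
  qed
  have \<theta>s: "Ad G (lie_exp G (t *\<^sub>R \<xi>)) \<eta> = lform K (0, t) (1, 0)" for t
  proof -
    let ?g = "lie_exp G (t *\<^sub>R \<xi>)"
    have "smooth_at (\<lambda>s. ?g \<odot> lie_exp G (s *\<^sub>R \<eta>) \<odot> ginv ?g) 0"
      by (intro smooth_at_mul smooth_at_const smooth_at_exp)
    then have "Ad G ?g \<eta> = lform (\<lambda>s. ?g \<odot> lie_exp G (s *\<^sub>R \<eta>) \<odot> ginv ?g) 0 1"
      unfolding Ad_def by (rule left_velocity_lform1)
    \<comment> \<open>The constant left factor \<open>?g\<close> of the conjugation does not affect
      the left velocity.\<close>
    also have "\<dots> = lform (\<lambda>s. K (s, t)) 0 1"
      by (simp only: grp.assoc lform_left_mul K_def lie_exp_minus fst_conv snd_conv)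
    also have "\<dots> = lform K (0, t) (1, 0)"
      by (rule lform_path) (auto intro!: K derivative_eq_intros simp: has_vector_derivative_def)
    finally show ?thesis .
  qed
  have \<theta>0: "lform K (0, 0) (1, 0) = \<eta>"
  proof -
    have "lform K (0, 0) (1, 0) = lform (\<lambda>s. K (s, 0)) 0 1"
      by (rule lform_path[symmetric]) (auto intro!: K derivative_eq_intros simp: has_vector_derivative_def)
    also have "\<dots> = \<eta>" by (simp add: K_def lie_exp_0 lform_exp)
    finally show ?thesis .
  qed
  have "ad G \<xi> \<eta> = FD (\<lambda>q. lform K q (1, 0)) (0, 0) (0, 1)"
    unfolding ad_def \<theta>s
    by (rule vector_derivative_at, rule smooth_on_has_vector_derivative_compose[OF lform_smooth[OF fd2, of UNIV]])
       (auto intro!: K derivative_eq_intros simp: has_vector_derivative_def)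
  moreover have "FD (\<lambda>q. lform K q (0, 1)) (0, 0) (1, 0) = 0"
  proof -
    have "(\<lambda>q. lform K q (0, 1)) = (\<lambda>q. - \<xi>)" using \<theta>t by auto
    then show ?thesis by (simp add: FD_eqI[OF has_derivative_const])
  qed
  ultimately show ?thesis
    using maurer_cartan[OF fd2 K, of "(1, 0)" "(0, 0)" "(0, 1)"] \<theta>t[of 0 0] \<theta>0
    by (simp add: linear_neg[OF mixed_linear_left] linear_neg[OF mixed_linear_right])
qed

lemma maurer_cartan_ad:
  fixes K :: "'a::real_inner \<Rightarrow> 'g"
  assumes "finite_dim TYPE('a)" "smooth_at K p"
  shows "FD (\<lambda>q. lform K q w) p v - FD (\<lambda>q. lform K q v) p w = ad G (lform K p w) (lform K p v)"
  unfolding ad_eq_mixed by (rule maurer_cartan[OF assms])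

lemma ad_star_apply: "blinfun_apply (ad_star G \<xi> \<mu>) \<eta> = blinfun_apply \<mu> (ad G \<xi> \<eta>)"
proof -
  have "linear (ad G \<xi>)"
    unfolding ad_eq_mixed by (intro linear_compose_sub mixed_linear_left mixed_linear_right)
  then have "bounded_linear (\<lambda>\<eta>. blinfun_apply \<mu> (ad G \<xi> \<eta>))"
    using finite_dim_bounded_linear[OF fd] bounded_linear_compose[OF blinfun.bounded_linear_right] by blast
  then show ?thesis unfolding ad_star_def by (simp add: bounded_linear_Blinfun_apply)
qed

section \<open>The reduced Lagrangian\<close>

lemma curve_at_0_iff: "curve_at_0 G c \<longleftrightarrow> (\<exists>r>0. \<forall>t\<in>{-r<..<r}. smooth_at c t)"
  unfolding curve_at_0_def by (simp add: smooth_map_on_vec_iff)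

text \<open>The translate \<open>d\<close> starts at the identity and has the left velocities of
  \<open>c\<close>, so the choice in \<open>reduced_lagrangian\<close> has a witness; left
  invariance then compares \<open>c\<close> with the chosen curve.\<close>

lemma lagrangian_eq_reduced:
  assumes "left_invariant G L" "curve_at_0 G c"
  shows "L (jet2 G c) = reduced_lagrangian G L (snd (left_triv2 G c))"
proof -
  define d where "d = (\<lambda>s. ginv (c 0) \<odot> c s)"
  have "ginv (d t) \<odot> d s = ginv (c t) \<odot> c s" for s t
    unfolding d_def by (metis grp.assoc grp.group_left_neutral grp.inverse_distrib_swap grp.left_inverse)
  then have "left_velocity G d t UNIV = left_velocity G c t UNIV" for t
    unfolding left_velocity_def by simp
  then have "left_triv2 G d = (\<one>, snd (left_triv2 G c))"
    unfolding left_triv2_def by (simp add: d_def)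
  moreover have "curve_at_0 G d"
    using assms(2) smooth_at_mul[OF smooth_at_const] unfolding curve_at_0_iff d_def by fast
  ultimately have "\<exists>d. curve_at_0 G d \<and> left_triv2 G d = (\<one>, snd (left_triv2 G c))" by blast
  moreover define d' where "d' = (SOME d. curve_at_0 G d \<and> left_triv2 G d = (\<one>, snd (left_triv2 G c)))"
  ultimately have d': "curve_at_0 G d' \<and> left_triv2 G d' = (\<one>, snd (left_triv2 G c))"
    using someI_ex[of "\<lambda>d. curve_at_0 G d \<and> left_triv2 G d = (\<one>, snd (left_triv2 G c))"] by simp
  then have "snd (left_triv2 G c) = snd (left_triv2 G d')" by simp
  then have "L (jet2 G c) = L (jet2 G d')"
    using assms d' unfolding left_invariant_def by blast
  then show ?thesis unfolding reduced_lagrangian_def d'_def .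
qed

text \<open>The smooth extension of the coordinate expression is pulled back to the group on the
  open set where it takes values in the chart image. This gives two-sided curves at the end points
  of \<open>{0..a}\<close>.\<close>

lemma smooth_map_on_local_extension:
  assumes g: "smooth_map_on vec_atlas (charts G) S g" and t: "t \<in> S"
  obtains I h where "open I" "t \<in> I" "\<And>s. s \<in> I \<Longrightarrow> smooth_at h s" "\<And>s. s \<in> I \<inter> S \<Longrightarrow> h s = g s"
proof -
  from g t obtain U \<phi>' V \<psi> W F where U: "(U, \<phi>') \<in> vec_atlas" and W: "(V, \<psi>) \<in> charts G" "open W" "t \<in> W"
    "W \<subseteq> U" "g ` (W \<inter> S) \<subseteq> V" "smooth_on (\<phi>' ` W) F" "\<forall>q\<in>W \<inter> S. \<psi> (g q) = F (\<phi>' q)"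
    by (rule smooth_map_onE)
  have id: "\<phi>' = id" using U unfolding vec_atlas_def by simp
  note V = smooth_atlas_chart[OF atl W(1)]
  have F: "smooth_on W F" using W(6) unfolding id by simp
  define I where "I = W \<inter> F -` (\<psi> ` V)"
  have I: "open I" unfolding I_def
    using continuous_open_preimage[OF smooth_on_continuous[OF F] W(2) V(2)] by simp
  show thesis
  proof
    show "open I" by fact
    have "F t = \<psi> (g t)" "g t \<in> V" using W t id by auto
    then show "t \<in> I" using W(3) unfolding I_def by auto
    show "smooth_at (\<lambda>s. inv_into V \<psi> (F s)) s" if "s \<in> I" for s
      by (rule smooth_map_at_inv_chart[OF atl W(1) I that smooth_on_subset[OF F]]) (auto simp: I_def)
    show "inv_into V \<psi> (F s) = g s" if "s \<in> I \<inter> S" for s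
    proof -
      have "F s = \<psi> (g s)" "g s \<in> V" using that W(5,7) id unfolding I_def by auto
      then show ?thesis using V(4) by simp
    qed
  qed
qed

end

lemma partial_derivatives:
  fixes l :: "'e::real_normed_vector \<times> 'e \<Rightarrow> real"
  assumes "smooth_on UNIV l"
  shows "FD l p (v, w) = blinfun_apply (delta_xi l p) v + blinfun_apply (delta_u l p) w"
proof -
  obtain \<xi> u where p: "p = (\<xi>, u)" by (cases p)
  note D = smooth_on_has_derivative[OF assms UNIV_I]
  have "((\<lambda>\<xi>'. (\<xi>', u)) has_derivative (\<lambda>v. (v, 0))) (at \<xi>)" by (auto intro!: derivative_eq_intros)
  from has_derivative_compose[OF this D]
  have 1: "((\<lambda>\<xi>'. l (\<xi>', u)) has_derivative (\<lambda>v. FD l p (v, 0))) (at \<xi>)" unfolding p .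
  have "((\<lambda>u'. (\<xi>, u')) has_derivative (\<lambda>v. (0, v))) (at u)" by (auto intro!: derivative_eq_intros)
  from has_derivative_compose[OF this D]
  have 2: "((\<lambda>u'. l (\<xi>, u')) has_derivative (\<lambda>v. FD l p (0, v))) (at u)" unfolding p .
  have "blinfun_apply (delta_xi l p) v = FD l p (v, 0)"
    using frechet_derivative_at[OF 1, symmetric] has_derivative_bounded_linear[OF 1]
    by (simp add: delta_xi_def p bounded_linear_Blinfun_apply)
  moreover have "blinfun_apply (delta_u l p) w = FD l p (0, w)"
    using frechet_derivative_at[OF 2, symmetric] has_derivative_bounded_linear[OF 2]
    by (simp add: delta_u_def p bounded_linear_Blinfun_apply)
  ultimately show ?thesis using FD_add[OF assms UNIV_I, of p "(v, 0)" "(0, w)"] by simp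
qed

section \<open>Conservation of the momentum map\<close>

locale Lie_action = G: Lie G + H: Lie H
  for G :: "('g::{t2_space, second_countable_topology}, 'e::{real_inner, banach}) lie_data"
    and H :: "('h::{t2_space, second_countable_topology}, 'f::{real_inner, banach}) lie_data" +
  fixes \<Phi> :: "'h \<Rightarrow> 'g \<Rightarrow> 'g"
  assumes action: "left_action H G \<Phi>"
begin

lemma smooth_at_action:
  fixes p :: "'a::real_normed_vector"
  shows "H.smooth_at k p \<Longrightarrow> G.smooth_at c p \<Longrightarrow> G.smooth_at (\<lambda>q. \<Phi> (k q) (c q)) p"
  using action smooth_map_at_map2[OF H.atl H.fd G.atl G.fd, of "charts G" \<Phi>] unfolding left_action_def by blast

text \<open>The two-parameter surface, with \<epsilon> first and time second, to which the
  Maurer--Cartan equation is applied.\<close>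

definition family :: "'f \<Rightarrow> (real \<Rightarrow> 'g) \<Rightarrow> real \<times> real \<Rightarrow> 'g" where
  "family \<zeta> c = (\<lambda>z. \<Phi> (lie_exp H (fst z *\<^sub>R \<zeta>)) (c (snd z)))"

lemma smooth_at_family:
  assumes "G.smooth_at c t"
  shows "G.smooth_at (family \<zeta> c) (\<epsilon>, t)"
  unfolding family_def using assms
  by (intro smooth_at_action smooth_map_at_linear_compose[OF finite_dim_euclidean H.smooth_at_exp bounded_linear_fst]
       smooth_map_at_linear_compose[OF finite_dim_euclidean _ bounded_linear_snd]) simp

lemma lform_family_t:
  assumes "G.smooth_at c t"
  shows "G.lform (family \<zeta> c) (\<epsilon>, t) (0, 1) = G.lform (\<lambda>t. \<Phi> (lie_exp H (\<epsilon> *\<^sub>R \<zeta>)) (c t)) t 1"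
proof -
  have "G.lform (\<lambda>t. family \<zeta> c (\<epsilon>, t)) t 1 = G.lform (family \<zeta> c) (\<epsilon>, t) (0, 1)"
    by (rule G.lform_path)
       (auto intro!: smooth_at_family assms derivative_eq_intros simp: has_vector_derivative_def)
  then show ?thesis by (simp add: family_def)
qed

text \<open>\<open>tangent_map\<close> represents a tangent vector by the curve \<open>d\<close>
  built from \<open>lie_exp\<close>. It has the same value and left velocity as \<open>c\<close> at
  \<open>t\<close>, so by \<open>lform_map\<close> the images under the action have equal left
  velocities.\<close>

lemma generator_TG_eq:
  fixes \<zeta> :: 'f
  assumes I: "open I" "t \<in> I" and c: "\<And>t. t \<in> I \<Longrightarrow> G.smooth_at c t"
  defines "K \<equiv> family \<zeta> c"
  shows "generator_TG H G \<Phi> \<zeta> (c t, G.lform c t 1) =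
    (G.lform K (0, t) (1, 0), FD (\<lambda>p. G.lform K p (0, 1)) (0, t) (1, 0))"
proof -
  have K: "G.smooth_at K (\<epsilon>, s)" if "s \<in> I" for \<epsilon> s unfolding K_def by (rule smooth_at_family[OF c[OF that]])
  have P: "((\<lambda>\<epsilon>. (\<epsilon>, t)) has_vector_derivative (1, 0)) (at \<epsilon>)" for \<epsilon> :: real
    by (auto intro!: derivative_eq_intros simp: has_vector_derivative_def)
  have "left_velocity G (\<lambda>\<epsilon>. K (\<epsilon>, t)) 0 UNIV = G.lform K (0, t) (1, 0)"
    by (rule G.left_velocity_lform[OF K[OF I(2)] P])
  moreover have "left_velocity G (\<lambda>s. \<Phi> h (mul G (c t) (lie_exp G (s *\<^sub>R G.lform c t 1)))) 0 UNIV
     = G.lform (\<lambda>t. \<Phi> h (c t)) t 1" for h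
  proof -
    define d where "d = (\<lambda>s. mul G (c t) (lie_exp G (s *\<^sub>R G.lform c t 1)))"
    have d: "G.smooth_at d 0" unfolding d_def by (intro G.smooth_at_mul G.smooth_at_const G.smooth_at_exp)
    have d0: "d 0 = c t" unfolding d_def by (simp add: G.lie_exp_0)
    have d1: "G.lform d 0 1 = G.lform c t 1" unfolding d_def by (simp add: G.lform_left_mul G.lform_exp)
    have Q: "G.smooth_at (\<lambda>y. \<Phi> h (mul G (c t) (G.\<phi>i y))) G.x0"
      by (intro smooth_at_action H.smooth_at_const G.smooth_at_mul G.smooth_at_const G.smooth_at_\<phi>i G.x0)
    have "left_velocity G (\<lambda>s. \<Phi> h (d s)) 0 UNIV = G.lform (\<lambda>s. \<Phi> h (d s)) 0 1"
      by (rule G.left_velocity_lform1) (intro smooth_at_action H.smooth_at_const d)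
    also have "\<dots> = G.lform (\<lambda>y. \<Phi> h (mul G (d 0) (G.\<phi>i y))) G.x0 (G.lform d 0 1)"
      by (rule G.lform_map[OF d]) (use Q d0 in simp)
    also have "\<dots> = G.lform (\<lambda>t. \<Phi> h (c t)) t 1"
      unfolding d0 d1 by (rule G.lform_map[OF c[OF I(2)] Q, symmetric])
    finally show ?thesis unfolding d_def .
  qed
  then have "(\<lambda>\<epsilon>. snd (tangent_map G (\<Phi> (lie_exp H (\<epsilon> *\<^sub>R \<zeta>))) (c t, G.lform c t 1))) = (\<lambda>\<epsilon>. G.lform K (\<epsilon>, t) (0, 1))"
    unfolding tangent_map_def K_def by (simp add: lform_family_t[OF c[OF I(2)]])
  moreover have "vector_derivative (\<lambda>\<epsilon>. G.lform K (\<epsilon>, t) (0, 1)) (at 0) = FD (\<lambda>p. G.lform K p (0, 1)) (0, t) (1, 0)"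
    by (rule vector_derivative_at, rule smooth_on_has_vector_derivative_compose[OF G.lform_smooth[OF finite_dim_euclidean, of "UNIV \<times> I"]])
       (use K I(2) P in auto)
  ultimately show ?thesis
    unfolding generator_TG_def by (simp add: tangent_map_def K_def family_def)
qed

text \<open>The arguments on the left are the trivialised second-order data of the transformed
  curve. The right-hand side is free of \<epsilon>, which is the form in which invariance gets
  differentiated.\<close>

lemma reduced_lagrangian_family:
  fixes \<zeta> :: 'f
  assumes L: "left_invariant G L" and inv: "\<And>h c. curve_at_0 G c \<Longrightarrow> L (jet2 G (\<Phi> h \<circ> c)) = L (jet2 G c)"
    and I: "open I" "t \<in> I" and c: "\<And>t. t \<in> I \<Longrightarrow> G.smooth_at c t"
  defines "K \<equiv> family \<zeta> c"
  shows "reduced_lagrangian G L (G.lform K (\<epsilon>, t) (0, 1), FD (\<lambda>p. G.lform K p (0, 1)) (\<epsilon>, t) (0, 1))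
    = L (jet2 G (\<lambda>s. c (t + s)))"
proof -
  have K: "G.smooth_at K (\<epsilon>, s)" if "s \<in> I" for \<epsilon> s unfolding K_def by (rule smooth_at_family[OF c[OF that]])
  obtain r where r: "r > 0" "ball t r \<subseteq> I" using I open_contains_ball by blast
  have tI: "t + s \<in> I" if "s \<in> {-r<..<r}" for s using r that by (auto simp: subset_iff dist_real_def)
  define d where "d = (\<lambda>s. c (t + s))"
  define k where "k = (\<lambda>s. K (\<epsilon>, t + s))"
  have P: "((\<lambda>s. (\<epsilon>, t + s)) has_vector_derivative (0, 1)) (at s)" for s
    by (auto intro!: derivative_eq_intros simp: has_vector_derivative_def)
  have d: "curve_at_0 G d"
    unfolding G.curve_at_0_iff d_def
  proof (intro exI conjI ballI)
    fix s assume "s \<in> {-r<..<r}"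
    then have "G.smooth_at c (t + 1 * s)" using c tI by simp
    from smooth_map_at_affine[OF this] show "G.smooth_at (\<lambda>s. c (t + s)) s" by simp
  qed (rule r(1))
  have kd: "k = \<Phi> (lie_exp H (\<epsilon> *\<^sub>R \<zeta>)) \<circ> d" unfolding k_def d_def K_def family_def by auto
  have "curve_at_0 G k"
    using d smooth_at_action[OF H.smooth_at_const] unfolding kd G.curve_at_0_iff comp_def by fast
  then have "L (jet2 G k) = reduced_lagrangian G L (snd (left_triv2 G k))"
    by (rule G.lagrangian_eq_reduced[OF L])
  moreover have vel: "left_velocity G k s UNIV = G.lform K (\<epsilon>, t + s) (0, 1)" if "s \<in> {-r<..<r}" for s
    unfolding k_def by (rule G.left_velocity_lform[OF K[OF tI[OF that]] P])
  moreover have "vector_derivative (\<lambda>s. left_velocity G k s UNIV) (at 0) = FD (\<lambda>p. G.lform K p (0, 1)) (\<epsilon>, t) (0, 1)"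
  proof (rule vector_derivative_at)
    have "((\<lambda>s. G.lform K (\<epsilon>, t + s) (0, 1)) has_vector_derivative FD (\<lambda>p. G.lform K p (0, 1)) (\<epsilon>, t + 0) (0, 1)) (at 0)"
      by (rule smooth_on_has_vector_derivative_compose[OF G.lform_smooth[OF finite_dim_euclidean, of "UNIV \<times> I"]])
         (use K I(2) P in auto)
    then have "((\<lambda>s. G.lform K (\<epsilon>, t + s) (0, 1)) has_vector_derivative FD (\<lambda>p. G.lform K p (0, 1)) (\<epsilon>, t) (0, 1)) (at 0)"
      by simp
    then show "((\<lambda>s. left_velocity G k s UNIV) has_vector_derivative FD (\<lambda>p. G.lform K p (0, 1)) (\<epsilon>, t) (0, 1)) (at 0)"
      by (rule has_vector_derivative_transform_within_open[where S="{-r<..<r}"]) (use r(1) vel in \<open>auto\<close>)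
  qed
  ultimately have "L (jet2 G k) = reduced_lagrangian G L (G.lform K (\<epsilon>, t) (0, 1), FD (\<lambda>p. G.lform K p (0, 1)) (\<epsilon>, t) (0, 1))"
    using r(1) by (simp add: left_triv2_def)
  then show ?thesis using inv[OF d] unfolding kd d_def by simp
qed

text \<open>Near each \<open>t\<close>, end points included, \<open>g\<close> is replaced by an extension that is smooth on an open interval, so that
  all derivatives but those of \<open>\<mu>\<close>, \<open>\<nu>\<close> and \<open>\<xi>\<close> are two-sided.\<close>

lemma momentum_derivative:
  fixes \<mu> \<nu> :: "real \<Rightarrow> ('e \<Rightarrow>\<^sub>L real)"
  assumes L: "left_invariant G L" and inv: "\<And>h c. curve_at_0 G c \<Longrightarrow> L (jet2 G (\<Phi> h \<circ> c)) = L (jet2 G c)"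
    and smooth: "smooth_on UNIV (reduced_lagrangian G L)"
    and a: "a > 0" and g: "smooth_map_on vec_atlas (charts G) {0..a} g"
    and HP: "HOHP_equations G (reduced_lagrangian G L) a g \<xi> u \<mu> \<nu>" and t: "t \<in> {0..a}"
  shows "((\<lambda>t. blinfun_apply (\<mu> t) (fst (generator_TG H G \<Phi> \<zeta> (g t, \<xi> t))) +
      blinfun_apply (\<nu> t) (snd (generator_TG H G \<Phi> \<zeta> (g t, \<xi> t)))) has_vector_derivative 0) (at t within {0..a})"
proof -
  define l where "l = reduced_lagrangian G L"
  obtain I c where I: "open I" "t \<in> I" and c: "\<And>s. s \<in> I \<Longrightarrow> G.smooth_at c s"
    and cg: "\<And>s. s \<in> I \<inter> {0..a} \<Longrightarrow> c s = g s"
    using G.smooth_map_on_local_extension[OF g t] by metis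
  have near: "\<exists>d>0. \<forall>s'\<in>{0..a}. dist s' s < d \<longrightarrow> s' \<in> I" if "s \<in> I" for s
    using I(1) that unfolding open_dist by metis
  \<comment> \<open>\<open>c\<close> and \<open>g\<close> agree only inside \<open>{0..a}\<close>,
    so the velocities are compared through derivatives within that interval, which are unique
    because \<open>a > 0\<close>.\<close>
  have \<xi>: "\<xi> s = G.lform c s 1" if s: "s \<in> I \<inter> {0..a}" for s
  proof -
    obtain d where d: "d > 0" "\<And>s'. s' \<in> {0..a} \<Longrightarrow> dist s' s < d \<Longrightarrow> s' \<in> I" using near s by blast
    have "has_left_velocity G c (G.lform c s 1) s {0..a}"
      by (rule G.lform_has_left_velocity[where \<gamma>="\<lambda>t. t"]) (use s c in \<open>auto intro: has_vector_derivative_id\<close>)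
    then have "((\<lambda>s'. unit_chart G (mul G (inver G (g s)) (g s'))) has_vector_derivative G.lform c s 1) (at s within {0..a})"
      unfolding has_left_velocity_def
      by (rule has_vector_derivative_transform_within[OF _ d(1)]) (use s d(2) cg in auto)
    moreover have "((\<lambda>s'. unit_chart G (mul G (inver G (g s)) (g s'))) has_vector_derivative \<xi> s) (at s within {0..a})"
      using HP s unfolding HOHP_equations_def has_left_velocity_def by blast
    ultimately show ?thesis
      using vector_derivative_unique_within_closed_interval[of 0 a s] a s by (metis IntD2 box_real(2))
  qed
  define K where "K = family \<zeta> c"
  \<comment> \<open>In the notation of the introduction, \<open>\<Xi> (\<epsilon>, t)\<close> is the
    velocity \<open>\<xi>\<^sub>\<epsilon>(t)\<close>, \<open>\<eta> (0, t)\<close> is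
    \<open>\<eta>(t)\<close>, and \<open>\<Xi>e (0, t)\<close> is the variation
    \<open>\<delta>\<xi>\<close>.\<close>
  define \<Xi> where "\<Xi> = (\<lambda>p. G.lform K p (0, 1))"
  define \<eta> where "\<eta> = (\<lambda>p. G.lform K p (1, 0))"
  define \<Xi>t where "\<Xi>t = (\<lambda>p. FD \<Xi> p (0, 1))"
  define \<Xi>e where "\<Xi>e = (\<lambda>p. FD \<Xi> p (1, 0))"
  let ?\<Omega> = "(UNIV :: real set) \<times> I"
  have K: "G.smooth_at K p" if "p \<in> ?\<Omega>" for p
    using that unfolding K_def by (auto intro: smooth_at_family c)
  have \<Omega>: "open ?\<Omega>" "(\<epsilon>, t) \<in> ?\<Omega>" for \<epsilon> using I by (auto intro: open_Times)
  have s\<Xi>: "smooth_on ?\<Omega> \<Xi>" and s\<eta>: "smooth_on ?\<Omega> \<eta>"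
    unfolding \<Xi>_def \<eta>_def by (rule G.lform_smooth[OF finite_dim_euclidean K]; assumption)+
  have s\<Xi>t: "smooth_on ?\<Omega> \<Xi>t" and s\<Xi>e: "smooth_on ?\<Omega> \<Xi>e"
    unfolding \<Xi>t_def \<Xi>e_def by (rule smooth_on_FD[OF s\<Xi>])+
  have dt: "((\<lambda>s. f (0, s)) has_vector_derivative FD f (0, t) (0, 1)) (at t within T)"
    if "smooth_on ?\<Omega> f" for f :: "real \<times> real \<Rightarrow> 'e" and T
    by (rule smooth_on_has_vector_derivative_compose[OF that])
       (use \<Omega>(2) in \<open>auto intro!: derivative_eq_intros simp: has_vector_derivative_def\<close>)
  have de: "((\<lambda>\<epsilon>. f (\<epsilon>, t)) has_vector_derivative FD f (0, t) (1, 0)) (at 0)"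
    if "smooth_on ?\<Omega> f" for f :: "real \<times> real \<Rightarrow> 'e"
    by (rule smooth_on_has_vector_derivative_compose[OF that])
       (use \<Omega>(2) in \<open>auto intro!: derivative_eq_intros simp: has_vector_derivative_def\<close>)
  have \<Xi>0: "\<Xi> (0, s) = \<xi> s" if "s \<in> I \<inter> {0..a}" for s
  proof -
    have "\<Phi> (lie_exp H (0 *\<^sub>R \<zeta>)) x = x" for x
      using action unfolding left_action_def by (simp add: H.lie_exp_0)
    then show ?thesis
      using \<xi>[OF that] lform_family_t[OF c, of s \<zeta> 0] that unfolding \<Xi>_def K_def by simp
  qed
  obtain \<nu>' where eqs: "(\<mu> has_vector_derivative ad_star G (\<xi> t) (\<mu> t)) (at t within {0..a})"
    "(\<nu> has_vector_derivative \<nu>') (at t within {0..a})" "\<mu> t = delta_xi l (\<xi> t, u t) - \<nu>'"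
    "\<nu> t = delta_u l (\<xi> t, u t)" "(\<xi> has_vector_derivative u t) (at t within {0..a})"
    using HP t unfolding HOHP_equations_def l_def by blast
  obtain d where d: "d > 0" "\<And>s'. s' \<in> {0..a} \<Longrightarrow> dist s' t < d \<Longrightarrow> s' \<in> I" using near I(2) by blast
  have "(\<xi> has_vector_derivative \<Xi>t (0, t)) (at t within {0..a})"
    unfolding \<Xi>t_def
    by (rule has_vector_derivative_transform_within[OF dt[OF s\<Xi>] d(1) t]) (use \<Xi>0 d(2) in auto)
  then have u: "\<Xi>t (0, t) = u t"
    using vector_derivative_unique_within_closed_interval[of 0 a t] a t eqs(5) by (metis box_real(2))
  \<comment> \<open>The \<epsilon>-derivative at 0 of the reduced Lagrangian along the family;
    exchanging the mixed derivatives of \<open>\<Xi>\<close> writes the variation of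
    \<open>u\<close> as the time derivative of \<open>\<Xi>e\<close>.\<close>
  have stationary: "blinfun_apply (delta_xi l (\<xi> t, u t)) (\<Xi>e (0, t)) +
      blinfun_apply (delta_u l (\<xi> t, u t)) (FD \<Xi>e (0, t) (0, 1)) = 0"
  proof -
    have "((\<lambda>\<epsilon>. (\<Xi> (\<epsilon>, t), \<Xi>t (\<epsilon>, t))) has_vector_derivative (\<Xi>e (0, t), FD \<Xi>t (0, t) (1, 0))) (at 0)"
      unfolding \<Xi>e_def by (rule has_vector_derivative_Pair[OF de[OF s\<Xi>] de[OF s\<Xi>t]])
    from smooth_on_has_vector_derivative_compose[OF smooth UNIV_I this]
    have D: "((\<lambda>\<epsilon>. l (\<Xi> (\<epsilon>, t), \<Xi>t (\<epsilon>, t))) has_vector_derivative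
       FD l (\<Xi> (0, t), \<Xi>t (0, t)) (\<Xi>e (0, t), FD \<Xi>t (0, t) (1, 0))) (at 0)" unfolding l_def .
    have inv: "l (\<Xi> (\<epsilon>, t), \<Xi>t (\<epsilon>, t)) = L (jet2 G (\<lambda>s. c (t + s)))" for \<epsilon>
      unfolding l_def \<Xi>_def \<Xi>t_def K_def by (rule reduced_lagrangian_family[OF L inv I c])
    have "((\<lambda>\<epsilon>. l (\<Xi> (\<epsilon>, t), \<Xi>t (\<epsilon>, t))) has_vector_derivative 0) (at 0)"
      unfolding inv by (rule has_vector_derivative_const)
    with D have "FD l (\<Xi> (0, t), \<Xi>t (0, t)) (\<Xi>e (0, t), FD \<Xi>t (0, t) (1, 0)) = 0"
      by (rule vector_derivative_unique_at)
    moreover have "FD \<Xi>t (0, t) (1, 0) = FD \<Xi>e (0, t) (0, 1)"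
      unfolding \<Xi>t_def \<Xi>e_def by (rule FD_commute[OF \<Omega> s\<Xi>])
    ultimately show ?thesis
      using partial_derivatives[OF smooth] \<Xi>0 I(2) t u unfolding l_def by simp
  qed
  have mc: "\<Xi>e (0, t) = FD \<eta> (0, t) (0, 1) + ad G (\<xi> t) (\<eta> (0, t))"
    using G.maurer_cartan_ad[OF finite_dim_euclidean K[OF \<Omega>(2)[of 0]], where w="(0, 1)" and v="(1, 0)"] \<Xi>0[of t] I(2) t
    unfolding \<Xi>e_def \<Xi>_def \<eta>_def by (simp add: algebra_simps)
  note bil = bounded_bilinear.has_vector_derivative[OF bounded_bilinear_blinfun_apply]
  have "((\<lambda>s. blinfun_apply (\<mu> s) (\<eta> (0, s)) + blinfun_apply (\<nu> s) (\<Xi>e (0, s))) has_vector_derivative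
    (blinfun_apply (\<mu> t) (FD \<eta> (0, t) (0, 1)) + blinfun_apply (ad_star G (\<xi> t) (\<mu> t)) (\<eta> (0, t))) +
    (blinfun_apply (\<nu> t) (FD \<Xi>e (0, t) (0, 1)) + blinfun_apply \<nu>' (\<Xi>e (0, t)))) (at t within {0..a})"
    by (intro has_vector_derivative_add bil eqs dt s\<eta> s\<Xi>e)
  \<comment> \<open>By \<open>mc\<close> the two \<mu>-terms combine to \<mu> applied to
    \<open>\<Xi>e\<close>. Adding the \<open>\<nu>'\<close> term gives \<open>delta_xi\<close> on
    \<open>\<Xi>e\<close>, and together with the remaining term this is the expression in
    \<open>stationary\<close>.\<close>
  moreover have "(blinfun_apply (\<mu> t) (FD \<eta> (0, t) (0, 1)) + blinfun_apply (ad_star G (\<xi> t) (\<mu> t)) (\<eta> (0, t))) +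
    (blinfun_apply (\<nu> t) (FD \<Xi>e (0, t) (0, 1)) + blinfun_apply \<nu>' (\<Xi>e (0, t))) = 0"
  proof -
    have "blinfun_apply (\<mu> t) (FD \<eta> (0, t) (0, 1)) + blinfun_apply (ad_star G (\<xi> t) (\<mu> t)) (\<eta> (0, t)) =
      blinfun_apply (\<mu> t) (\<Xi>e (0, t))"
      unfolding mc G.ad_star_apply by (simp add: blinfun.add_right)
    then show ?thesis using stationary unfolding eqs(3,4) by (simp add: blinfun.diff_left)
  qed
  ultimately have "((\<lambda>s. blinfun_apply (\<mu> s) (\<eta> (0, s)) + blinfun_apply (\<nu> s) (\<Xi>e (0, s))) has_vector_derivative 0)
     (at t within {0..a})" by simp
  then show ?thesis
  proof (rule has_vector_derivative_transform_within[OF _ d(1) t])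
    fix s assume s: "s \<in> {0..a}" "dist s t < d"
    then have "s \<in> I" using d(2) by blast
    then have "generator_TG H G \<Phi> \<zeta> (g s, \<xi> s) = (\<eta> (0, s), \<Xi>e (0, s))"
      using generator_TG_eq[OF I(1) _ c, of s \<zeta>] \<xi>[of s] cg[of s] s(1)
      unfolding \<eta>_def \<Xi>e_def \<Xi>_def K_def by simp
    then show "blinfun_apply (\<mu> s) (\<eta> (0, s)) + blinfun_apply (\<nu> s) (\<Xi>e (0, s)) =
      blinfun_apply (\<mu> s) (fst (generator_TG H G \<Phi> \<zeta> (g s, \<xi> s))) +
      blinfun_apply (\<nu> s) (snd (generator_TG H G \<Phi> \<zeta> (g s, \<xi> s)))" by simp
  qed
qed

end

theorem mainTheorem3:
  fixes G :: "('g::{t2_space, second_countable_topology}, 'e::{real_inner, banach}) lie_data"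
    and H :: "('h::{t2_space, second_countable_topology}, 'f::{real_inner, banach}) lie_data"
    and L :: "(real \<Rightarrow> 'g) set \<Rightarrow> real"
    and \<Phi> :: "'h \<Rightarrow> 'g \<Rightarrow> 'g"
    and a :: real
    and g :: "real \<Rightarrow> 'g"
    and \<xi> u :: "real \<Rightarrow> 'e"
    and \<mu> \<nu> :: "real \<Rightarrow> ('e \<Rightarrow>\<^sub>L real)"
  assumes "lie_group G" and "lie_group H"
    and "left_invariant G L"
    and "smooth_on UNIV (reduced_lagrangian G L)"
    and "hyper_regular G (reduced_lagrangian G L)"
    and "left_action H G \<Phi>"
    and "\<And>h c. curve_at_0 G c \<Longrightarrow> L (jet2 G (\<Phi> h \<circ> c)) = L (jet2 G c)"
    and "a > 0"
    and "solves_hamilton_principle G L a g"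
    and "HOHP_equations G (reduced_lagrangian G L) a g \<xi> u \<mu> \<nu>"
  shows "\<forall>t\<in>{0..a}. momentum_map H G \<Phi> (g t, \<xi> t, \<mu> t, \<nu> t)
                   = momentum_map H G \<Phi> (g 0, \<xi> 0, \<mu> 0, \<nu> 0)"
proof
  fix t assume t: "t \<in> {0..a}"
  interpret Lie_action G H \<Phi>
    using assms(1,2,6) by (intro Lie_action.intro Lie.intro Lie_action_axioms.intro)
  have g: "smooth_map_on vec_atlas (charts G) {0..a} g"
    using assms(9) unfolding solves_hamilton_principle_def by blast
  have "blinfun_apply (\<mu> t) (fst (generator_TG H G \<Phi> \<zeta> (g t, \<xi> t))) +
      blinfun_apply (\<nu> t) (snd (generator_TG H G \<Phi> \<zeta> (g t, \<xi> t))) =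
     blinfun_apply (\<mu> 0) (fst (generator_TG H G \<Phi> \<zeta> (g 0, \<xi> 0))) +
      blinfun_apply (\<nu> 0) (snd (generator_TG H G \<Phi> \<zeta> (g 0, \<xi> 0)))" for \<zeta>
    \<comment> \<open>For each fixed \<zeta> the pairing has zero derivative on the convex set
      \<open>{0..a}\<close>, so its values at \<open>t\<close> and 0 agree.\<close>
    using has_vector_derivative_zero_constant[OF _ momentum_derivative[OF assms(3,7,4,8) g assms(10)], of \<zeta>]
      t \<open>a > 0\<close> convex_real_interval(5) by (metis atLeastAtMost_iff less_imp_le order_refl)
  then show "momentum_map H G \<Phi> (g t, \<xi> t, \<mu> t, \<nu> t) = momentum_map H G \<Phi> (g 0, \<xi> 0, \<mu> 0, \<nu> 0)"
    unfolding momentum_map_def by simp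
qed

end
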